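(* Let $P\subset p\Sigma\subset\mathbb{R}^m$ be a convex integral polytope ($p$ a positive integer) with $P\not\subset\partial(p\Sigma)$, and let $\psi_P$ be the limit expected zero current of $P$. Then $\psi_P$ vanishes along the orbits of the normal flow; that is, for every face $F$ of $P$ not contained in $\partial(p\Sigma)$ and every maximal orbit $O=\widetilde C_F\cdot z^0$, $z^0\in\mu^{-1}(\frac1pF)$, one has $\psi_P|_O=0$.
   Context: $\Sigma=\{x\in\mathbb{R}^m: x_j\ge 0,\ \sum_j x_j\le 1\}$; $\mathbb{C}^*=\mathbb{C}\setminus\{0\}$. A convex integral polytope is the convex hull of a finite set of points of $\mathbb{Z}^m$. $\mu(z)=\left(\frac{|z_1|^2}{1+\|z\|^2},\dots,\frac{|z_m|^2}{1+\|z\|^2}\right)$ on $(\mathbb{C}^* )^m$; $\omega_{FS}=\frac{\sqrt{-1}}{2\pi}\partial\bar\partial\log(1+\|z\|^2)$; $e^\eta\cdot z=(e^{\eta_1}z_1,\dots,e^{\eta_m}z_m)$ for $\eta\in\mathbb{C}^m$. Faces: $C_x=\{u\in\mathbb{R}^m:\langle u,x\rangle=\sup_{y\in P}\langle u,y\rangle\}$ for $x\in P$; the faces of $P$ are the equivalence classes of $x\sim y\iff C_x=C_y$ (disjoint, relatively open; the relative interior of $P$ is a face); $C_F=C_x$ for $x\in F$. For a face $F\not\subset\partial(p\Sigma)$, $\mathcal{R}_F=\{e^\tau\cdot z:\tau\in C_F,\ z\in(\mathbb{C}^* )^m,\ p\mu(z)\in F\}$. For each $z\in(\mathbb{C}^*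 )^m$ there are unique $q(z)\in P$, $\tau_z\in C_{q(z)}$ with $p\mu(e^{-\tau_z/2}\cdot z)=q(z)$. Put $b_P(z)=-\langle q(z),\tau_z\rangle+p\log\left(\frac{1+\|z\|^2}{1+\|e^{-\tau_z/2}\cdot z\|^2}\right)$; this function is $C^\infty$ on each region $\mathcal{R}_F$ (up to the boundary). The limit expected zero current (the limit as $N\to\infty$ of $N^{-1}$ times the expected zero current of a Gaussian random polynomial with Newton polytope $NP$) is the closed semipositive $(1,1)$-form with piecewise $C^\infty$ coefficients given on each of the regions $\mathcal{R}_F$ by $\psi_P=p\,\omega_{FS}-\frac{\sqrt{-1}}{2\pi}\partial\bar\partial b_P$. Normal flow: let $T_F\subset\mathbb{R}^m$ be the tangent space of $F$ and $T_F^\perp$ its orthogonal complement (so $C_F\subset T_F^\perp$). The complexified normal cone is the semigroup $\widetilde C_F=\{\tau+i\theta:\tau\in C_F,\ \theta\in T_F^\perp\}$; it acts on $\mathcal{R}_F$ by $z\mapsto e^\eta\cdot z$ (the normal flow). The maximal orbits are $\widetilde C_F\cdot z^0=\{e^\eta\cdot z^0:\eta\in\widetilde C_F\}$ with $z^0\in\mu^{-1}(\frac1pF)$; each is a complex $(m-\dim F)$-dimensional submanifold (with boundary) of $(\mathbb{C}^* )^m$. *)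

theory Defs
  imports "HOL-Analysis.Analysis"
begin

section \<open>Polytopes, faces and normal cones\<close>

definition std_simplex :: "(real^'m) set" where
  "std_simplex = {x. (\<forall>j. 0 \<le> x $ j) \<and> (\<Sum>j\<in>UNIV. x $ j) \<le> 1}"

definition scaled_simplex :: "nat \<Rightarrow> (real^'m) set" where
  "scaled_simplex p = (\<lambda>x. real p *\<^sub>R x) ` std_simplex"

definition integral_polytope :: "(real^'m) set \<Rightarrow> bool" where
  "integral_polytope P \<longleftrightarrow>
     (\<exists>S. finite S \<and> (\<forall>x\<in>S. \<forall>j. x $ j \<in> \<int>) \<and> P = convex hull S)"

definition normal_cone :: "(real^'m) set \<Rightarrow> real^'m \<Rightarrow> (real^'m) set" where
  "normal_cone P x = {u. u \<bullet> x = (SUP y\<in>P. u \<bullet> y)}"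

text \<open>Faces are relatively open: they are the classes of points with the same normal cone
  (so, unlike those of \<^const>\<open>face_of\<close>, distinct faces are disjoint).\<close>

definition open_faces :: "(real^'m) set \<Rightarrow> (real^'m) set set" where
  "open_faces P = P // {(x, y). x \<in> P \<and> y \<in> P \<and> normal_cone P x = normal_cone P y}"

text \<open>The normal cone is constant on a face, so the choice of the point is immaterial.\<close>

definition face_cone :: "(real^'m) set \<Rightarrow> (real^'m) set \<Rightarrow> (real^'m) set" where
  "face_cone P F = normal_cone P (SOME x. x \<in> F)"

definition face_tangent :: "(real^'m) set \<Rightarrow> (real^'m) set" where
  "face_tangent F = span {x - y | x y. x \<in> F \<and> y \<in> F}"


section \<open>The complex torus and the moment map\<close>

definition torus :: "(complex^'m) set" where
  "torus = {z. \<forall>j. z $ j \<noteq> 0}"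

definition cvec :: "real^'m \<Rightarrow> complex^'m" where
  "cvec x = (\<chi> j. complex_of_real (x $ j))"

definition exp_act :: "complex^'m \<Rightarrow> complex^'m \<Rightarrow> complex^'m" where
  "exp_act \<eta> z = (\<chi> j. exp (\<eta> $ j) * z $ j)"

definition moment_map :: "complex^'m \<Rightarrow> real^'m" where
  "moment_map z = (\<chi> j. (norm (z $ j))\<^sup>2 / (1 + (norm z)\<^sup>2))"

definition region :: "(real^'m) set \<Rightarrow> nat \<Rightarrow> (real^'m) set \<Rightarrow> (complex^'m) set" where
  "region P p F =
     {exp_act (cvec \<tau>) z | \<tau> z. \<tau> \<in> face_cone P F \<and> z \<in> torus \<and> real p *\<^sub>R moment_map z \<in> F}"

definition complexified_cone :: "(real^'m) set \<Rightarrow> (real^'m) set \<Rightarrow> (complex^'m) set" where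
  "complexified_cone P F =
     {(\<chi> j. Complex (\<tau> $ j) (\<theta> $ j)) | \<tau> \<theta>.
        \<tau> \<in> face_cone P F \<and> \<theta> \<in> orthogonal_comp (face_tangent F)}"

definition normal_orbit ::
    "(real^'m) set \<Rightarrow> (real^'m) set \<Rightarrow> complex^'m \<Rightarrow> (complex^'m) set" where
  "normal_orbit P F z0 = (\<lambda>\<eta>. exp_act \<eta> z0) ` complexified_cone P F"


section \<open>The decay function\<close>

text \<open>For \<open>z\<close> in the torus, the pair \<open>(q(z), \<tau>\<^sub>z)\<close>; it exists and is unique whenever
  \<open>P\<close> lies in \<open>p\<Sigma>\<close> but not in its boundary.\<close>

definition flow_data :: "(real^'m) set \<Rightarrow> nat \<Rightarrow> complex^'m \<Rightarrow> (real^'m) \<times> (real^'m)" where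
  "flow_data P p z =
     (THE (q, \<tau>). q \<in> P \<and> \<tau> \<in> normal_cone P q \<and>
        real p *\<^sub>R moment_map (exp_act (cvec (- (1 / 2) *\<^sub>R \<tau>)) z) = q)"

definition decay_fun :: "(real^'m) set \<Rightarrow> nat \<Rightarrow> complex^'m \<Rightarrow> real" where
  "decay_fun P p z =
     (case flow_data P p z of (q, \<tau>) \<Rightarrow>
        - (q \<bullet> \<tau>) + real p *
          ln ((1 + (norm z)\<^sup>2) / (1 + (norm (exp_act (cvec (- (1 / 2) *\<^sub>R \<tau>)) z))\<^sup>2)))"


section \<open>(1,1)-forms\<close>

definition wirtinger :: "'m \<Rightarrow> (complex^'m \<Rightarrow> complex) \<Rightarrow> complex^'m \<Rightarrow> complex" where
  "wirtinger j f z = (frechet_derivative f (at z) (axis j 1)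
                      - \<i> * frechet_derivative f (at z) (axis j \<i>)) / 2"

definition wirtinger_bar :: "'m \<Rightarrow> (complex^'m \<Rightarrow> complex) \<Rightarrow> complex^'m \<Rightarrow> complex" where
  "wirtinger_bar j f z = (frechet_derivative f (at z) (axis j 1)
                          + \<i> * frechet_derivative f (at z) (axis j \<i>)) / 2"

text \<open>A matrix \<open>H\<close> stands for the (1,1)-covector \<open>\<Sum>\<^sub>j\<^sub>k H\<^sub>j\<^sub>k dz\<^sub>j \<and> d(cnj z\<^sub>k)\<close>;
  \<open>form_eval H \<xi> \<zeta>\<close> is its value on two real tangent vectors, the real tangent space
  being identified with the space of complex vectors.\<close>

definition form_eval :: "complex^'m^'m \<Rightarrow> complex^'m \<Rightarrow> complex^'m \<Rightarrow> complex" where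
  "form_eval H \<xi> \<zeta> =
     (\<Sum>j\<in>UNIV. \<Sum>k\<in>UNIV. H $ j $ k * (\<xi> $ j * cnj (\<zeta> $ k) - \<zeta> $ j * cnj (\<xi> $ k)))"

text \<open>The coefficient matrix of \<open>(\<i> / 2\<pi>) \<partial>\<partial>\<close>-bar \<open>f\<close>.\<close>

definition ddbar :: "(complex^'m \<Rightarrow> real) \<Rightarrow> complex^'m \<Rightarrow> complex^'m^'m" where
  "ddbar f z = (\<chi> j k. \<i> / (2 * complex_of_real pi) *
      wirtinger j (wirtinger_bar k (\<lambda>w. complex_of_real (f w))) z)"

definition omega_FS :: "complex^'m \<Rightarrow> complex^'m^'m" where
  "omega_FS = ddbar (\<lambda>z. ln (1 + (norm z)\<^sup>2))"


section \<open>The limit expected zero current\<close>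

definition region_of :: "(real^'m) set \<Rightarrow> nat \<Rightarrow> complex^'m \<Rightarrow> (complex^'m) set" where
  "region_of P p z =
     region P p (THE F. F \<in> open_faces P \<and> \<not> F \<subseteq> frontier (scaled_simplex p) \<and> z \<in> region P p F)"

text \<open>The limit of \<open>1/N\<close> times the expected zero current of Gaussian random polynomials with
  Newton polytope \<open>NP\<close> is taken here through its explicit description as the piecewise smooth
  form \<open>p \<omega>\<^sub>F\<^sub>S - (\<i> / 2\<pi>) \<partial>\<partial>\<close>-bar \<open>b\<^sub>P\<close>; the convergence itself is not part of the definition.
  The regions partition the torus, but they are not open. The form \<open>\<psi>\<^sub>P\<close> is smooth on each
  region up to the boundary: at a point \<open>z\<close> of a region that is not an interior point of it,
  the coefficients are the limits of the coefficients at interior points of that same region.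
  (Across the boundary between two regions the coefficients jump in general.)\<close>

definition limit_zero_form :: "(real^'m) set \<Rightarrow> nat \<Rightarrow> complex^'m \<Rightarrow> complex^'m^'m" where
  "limit_zero_form P p z =
     (let \<psi> = (\<lambda>w. real p *\<^sub>R omega_FS w - ddbar (decay_fun P p) w);
          U = interior (region_of P p z)
      in if z \<in> U then \<psi> z else Lim (at z within U) \<psi>)"


section \<open>Restriction to a submanifold\<close>

text \<open>Tangent space of a submanifold with boundary or corners: at boundary points, the span of
  the one-sided velocities of curves in the submanifold.\<close>

definition tangent_space :: "(complex^'m) set \<Rightarrow> complex^'m \<Rightarrow> (complex^'m) set" where
  "tangent_space M w =
     span {v. \<exists>\<gamma>. \<gamma> 0 = w \<and> (\<forall>t\<in>{0..1}. \<gamma> t \<in> M) \<and>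
                 (\<gamma> has_vector_derivative v) (at 0 within {0..1})}"

definition restricts_to_zero :: "(complex^'m \<Rightarrow> complex^'m^'m) \<Rightarrow> (complex^'m) set \<Rightarrow> bool" where
  "restricts_to_zero \<Psi> M \<longleftrightarrow>
     (\<forall>w\<in>M. \<forall>\<xi>\<in>tangent_space M w. \<forall>\<zeta>\<in>tangent_space M w. form_eval (\<Psi> w) \<xi> \<zeta> = 0)"

end

theory Submission
  imports Defs
begin

text \<open>In the logarithmic coordinates \<open>r\<^sub>j = log \<bar>z\<^sub>j\<bar>\<^sup>2\<close> the potential \<open>p log (1 + \<parallel>z\<parallel>\<^sup>2) - b\<^sub>P\<close> of
  \<open>\<psi>\<^sub>P\<close> is a function \<open>h(r)\<close>, essentially the Legendre transform of the entropy restricted to \<open>P\<close>;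
  its gradient at \<open>r\<close> is \<open>q(z)\<close>. Hence \<open>\<psi>\<^sub>P\<close> has the coefficients \<open>(\<i> / 2\<pi>) (\<partial>q\<^sub>k / \<partial>r\<^sub>j) / (z\<^sub>j cnj z\<^sub>k)\<close>.
  On the region of \<open>F\<close> the point \<open>q\<close> moves inside \<open>F\<close>, so the derivative of \<open>q\<close> takes values in the
  tangent space of \<open>F\<close>, whereas \<open>\<xi>\<^sub>k / z\<^sub>k\<close> is orthogonal to it for \<open>\<xi>\<close> tangent to an orbit. At
  non-interior points of the region the same formula holds in the limit, because \<open>q\<close> extends to a
  continuously differentiable function of \<open>r\<close> on a neighbourhood of the region.\<close>

section \<open>The entropy of the simplex and its constrained Legendre transform\<close>

definition open_simplex :: "real \<Rightarrow> (real^'m) set" where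
  "open_simplex c = {x. (\<forall>j. 0 < x $ j) \<and> (\<Sum>j\<in>UNIV. x $ j) < c}"

text \<open>For \<open>c > 0\<close> this is Legendre dual, up to an additive constant, to
  \<open>c * ln (1 + (\<Sum>j. exp (r $ j)))\<close>, the Fubini-Study potential in logarithmic
  coordinates.\<close>

definition entropy :: "real \<Rightarrow> real^'m \<Rightarrow> real" where
  "entropy c x = (\<Sum>j\<in>UNIV. x $ j * ln (x $ j)) +
     (c - (\<Sum>j\<in>UNIV. x $ j)) * ln (c - (\<Sum>j\<in>UNIV. x $ j))"

definition entropy_grad :: "real \<Rightarrow> real^'m \<Rightarrow> real^'m" where
  "entropy_grad c x = (\<chi> j. ln (x $ j) - ln (c - (\<Sum>i\<in>UNIV. x $ i)))"

definition entropy_hess :: "real \<Rightarrow> real^'m \<Rightarrow> real^'m \<Rightarrow> real^'m" where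
  "entropy_hess c x v = (\<chi> j. v $ j / x $ j + (\<Sum>i\<in>UNIV. v $ i) / (c - (\<Sum>i\<in>UNIV. x $ i)))"

lemma open_open_simplex: "open (open_simplex c :: (real^'m) set)"
proof -
  have "open_simplex c = (\<Inter>j. {x :: real^'m. 0 < x $ j}) \<inter> {x. (\<Sum>j\<in>UNIV. x $ j) < c}"
    by (auto simp: open_simplex_def)
  moreover have "open {x :: real^'m. 0 < x $ j}" for j
    by (intro open_Collect_less continuous_intros)
  moreover have "open {x :: real^'m. (\<Sum>j\<in>UNIV. x $ j) < c}"
    by (intro open_Collect_less continuous_intros)
  ultimately show ?thesis
    by (auto intro!: open_INT)
qed

text \<open>The slack \<open>c - (\<Sum>j. x $ j)\<close> acts as one more coordinate: the pairing
  is a sum of terms \<open>(a - b) * (ln a - ln b)\<close>, all nonnegative, and one is positive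
  because some coordinate differs.\<close>

lemma entropy_grad_strict_mono:
  assumes x: "x \<in> open_simplex c" and y: "y \<in> open_simplex c" and "x \<noteq> y"
  shows "0 < (x - y) \<bullet> (entropy_grad c x - entropy_grad c y)"
proof -
  have mono: "0 \<le> (a - b) * (ln a - ln b)" if "0 < a" "0 < b" for a b :: real
    using that by (cases a b rule: linorder_cases) (auto intro!: mult_nonneg_nonneg mult_nonpos_nonpos)
  have strict: "0 < (a - b) * (ln a - ln b)" if "0 < a" "0 < b" "a \<noteq> b" for a b :: real
    using that by (cases a b rule: linorder_cases) (auto intro!: mult_pos_pos mult_neg_neg)
  define s t where "s = (\<Sum>j\<in>UNIV. x $ j)" and "t = (\<Sum>j\<in>UNIV. y $ j)"
  have pos: "0 < x $ j" "0 < y $ j" "0 < c - s" "0 < c - t" for j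
    using x y by (auto simp: open_simplex_def s_def t_def)
  obtain j where "x $ j \<noteq> y $ j"
    using \<open>x \<noteq> y\<close> by (auto simp: vec_eq_iff)
  have "(x - y) \<bullet> (entropy_grad c x - entropy_grad c y) =
      (\<Sum>j\<in>UNIV. (x $ j - y $ j) * (ln (x $ j) - ln (y $ j)) - (x $ j - y $ j) * (ln (c - s) - ln (c - t)))"
    by (auto simp: inner_vec_def entropy_grad_def s_def t_def algebra_simps intro!: sum.cong)
  also have "\<dots> = (\<Sum>j\<in>UNIV. (x $ j - y $ j) * (ln (x $ j) - ln (y $ j)))
      + ((c - s) - (c - t)) * (ln (c - s) - ln (c - t))"
    by (simp add: sum_subtractf s_def t_def flip: sum_distrib_right) (simp add: algebra_simps)
  also have "\<dots> > 0"
    using mono[OF pos(3,4)] \<open>x $ j \<noteq> y $ j\<close>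
    by (intro add_pos_nonneg sum_pos2[of _ j] mono strict pos) auto
  finally show ?thesis .
qed

text \<open>The quadratic form is a sum of squares with positive weights, again with one term for
  the slack.\<close>

lemma entropy_hess_pos:
  assumes x: "x \<in> open_simplex c" and "v \<noteq> 0"
  shows "0 < v \<bullet> entropy_hess c x v"
proof -
  define s t where "s = (\<Sum>j\<in>UNIV. x $ j)" and "t = (\<Sum>j\<in>UNIV. v $ j)"
  have pos: "0 < x $ j" "0 < c - s" for j
    using x by (auto simp: open_simplex_def s_def)
  obtain j where "v $ j \<noteq> 0"
    using \<open>v \<noteq> 0\<close> by (auto simp: vec_eq_iff)
  have "v \<bullet> entropy_hess c x v = (\<Sum>j\<in>UNIV. v $ j * v $ j / x $ j + v $ j * (t / (c - s)))"
    by (auto simp: inner_vec_def entropy_hess_def s_def t_def algebra_simps intro!: sum.cong)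
  also have "\<dots> = (\<Sum>j\<in>UNIV. v $ j * v $ j / x $ j) + t * t / (c - s)"
    by (simp add: sum.distrib t_def sum_distrib_right flip: sum_divide_distrib)
  also have "\<dots> > 0"
    using \<open>v $ j \<noteq> 0\<close> pos
    by (intro add_pos_nonneg sum_pos2[of _ j] divide_nonneg_pos divide_pos_pos) (auto simp: less_le)
  finally show ?thesis .
qed

lemma has_derivative_entropy:
  assumes x: "x \<in> open_simplex c"
  shows "(entropy c has_derivative (\<lambda>v. entropy_grad c x \<bullet> v)) (at x)"
proof -
  have pos: "0 < x $ j" "0 < c - (\<Sum>j\<in>UNIV. x $ j)" for j
    using x by (auto simp: open_simplex_def)
  note pos' = pos(1)[THEN less_imp_neq, THEN not_sym] pos(2)[THEN less_imp_neq, THEN not_sym]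
  show ?thesis
    unfolding entropy_def[abs_def]
    apply (rule derivative_eq_intros bounded_linear.has_derivative[OF bounded_linear_vec_nth] refl | rule pos)+
    apply (rule ext)
    using pos' pos
    apply (simp add: inner_vec_def entropy_grad_def sum.distrib sum_subtractf algebra_simps
        flip: sum_distrib_left sum_distrib_right)
    apply (simp add: field_simps)
    done
qed

lemma has_derivative_entropy_grad:
  assumes x: "x \<in> open_simplex c"
  shows "(entropy_grad c has_derivative entropy_hess c x) (at x)"
proof -
  have pos: "0 < x $ j" "0 < c - (\<Sum>j\<in>UNIV. x $ j)" for j
    using x by (auto simp: open_simplex_def)
  have "((\<lambda>y. entropy_grad c y $ j) has_derivative (\<lambda>v. entropy_hess c x v $ j)) (at x)" for j
    unfolding entropy_grad_def[abs_def] entropy_hess_def[abs_def] vec_lambda_beta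
    apply (rule derivative_eq_intros bounded_linear.has_derivative[OF bounded_linear_vec_nth] refl | rule pos)+
    apply (rule ext)
    apply (simp add: divide_inverse algebra_simps)
    done
  then show ?thesis
    by (subst has_derivative_componentwise_within) (auto simp: Basis_vec_def inner_axis)
qed

section \<open>Orthogonal projections, linear systems and the inverse of the constrained
  gradient\<close>

lemma obtain_orthogonal_projection:
  fixes T :: "'a::euclidean_space set"
  assumes "subspace T"
  obtains \<pi> where "linear \<pi>" "\<And>v. \<pi> v \<in> T" "\<And>u v. u \<in> T \<Longrightarrow> u \<bullet> (v - \<pi> v) = 0"
    "\<And>v. v \<in> T \<Longrightarrow> \<pi> v = v" "\<And>v. v \<in> T\<^sup>\<bottom> \<Longrightarrow> \<pi> v = 0"
proof -
  obtain B where B: "B \<subseteq> T" "pairwise orthogonal B" "\<And>x. x \<in> B \<Longrightarrow> norm x = 1"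
    "independent B" "span B = T"
    using orthonormal_basis_subspace[OF assms] by metis
  have fin: "finite B"
    using B(4) independent_imp_finite by blast
  define \<pi> where "\<pi> v = (\<Sum>b\<in>B. (b \<bullet> v) *\<^sub>R b)" for v
  have lin: "linear \<pi>"
    unfolding \<pi>_def by (intro linearI) (simp_all add: inner_add_right scaleR_add_left sum.distrib scaleR_sum_right)
  have mem: "\<pi> v \<in> T" for v
    unfolding \<pi>_def using B(1) assms by (intro subspace_sum subspace_scale) auto
  have basis: "b \<bullet> (v - \<pi> v) = 0" if "b \<in> B" for b v
  proof -
    have "b \<bullet> \<pi> v = (\<Sum>b'\<in>B. if b' = b then b \<bullet> v else 0)"
      unfolding \<pi>_def inner_sum_right inner_scaleR_right
    proof (rule sum.cong)
      fix b' assume "b' \<in> B"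
      show "(b' \<bullet> v) * (b \<bullet> b') = (if b' = b then b \<bullet> v else 0)"
      proof (cases "b' = b")
        case True
        then show ?thesis using B(3)[OF that] by (simp add: dot_square_norm)
      next
        case False
        then have "orthogonal b b'" using B(2) that \<open>b' \<in> B\<close> by (auto simp: pairwise_def)
        then show ?thesis using False by (simp add: orthogonal_def)
      qed
    qed simp
    then show ?thesis using that fin by (simp add: inner_diff_right)
  qed
  have orth: "u \<bullet> (v - \<pi> v) = 0" if "u \<in> T" for u v
  proof -
    have "orthogonal (v - \<pi> v) u"
      using that B(5) basis by (intro orthogonal_to_span[of u B]) (auto simp: orthogonal_def inner_commute)
    then show ?thesis by (simp add: orthogonal_def inner_commute)
  qed
  have id: "\<pi> v = v" if "v \<in> T" for v
  proof -
    have "v - \<pi> v \<in> T" using that mem assms by (simp add: subspace_diff)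
    from orth[OF this, of v] show ?thesis by simp
  qed
  have zero: "\<pi> v = 0" if "v \<in> T\<^sup>\<bottom>" for v
    using that B(1) by (auto simp: \<pi>_def orthogonal_comp_def orthogonal_def intro!: sum.neutral)
  show thesis
    using lin mem orth id zero by (rule that)
qed

lemma continuous_on_det:
  fixes A :: "'a::topological_space \<Rightarrow> real^'n^'n"
  assumes "\<And>i j. continuous_on S (\<lambda>x. A x $ i $ j)"
  shows "continuous_on S (\<lambda>x. det (A x))"
  unfolding det_def by (intro continuous_intros assms)

text \<open>Cramer's rule makes the solution of a linear system depend continuously on its data.\<close>

lemma continuous_on_linear_solve:
  fixes L :: "'a::topological_space \<Rightarrow> real^'n \<Rightarrow> real^'n"
  assumes lin: "\<And>x. x \<in> S \<Longrightarrow> linear (L x)" and inj: "\<And>x. x \<in> S \<Longrightarrow> inj (L x)"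
    and cont: "\<And>v. continuous_on S (\<lambda>x. L x v)"
    and sol: "\<And>x. x \<in> S \<Longrightarrow> L x (y x) = b"
  shows "continuous_on S y"
proof -
  have det: "det (matrix (L x)) \<noteq> 0" if "x \<in> S" for x
    using det_nz_iff_inj[OF lin[OF that]] inj[OF that] by simp
  have ent: "continuous_on S (\<lambda>x. matrix (L x) $ i $ j)" for i j
    unfolding matrix_def vec_lambda_beta by (intro continuous_intros cont)
  have sol_eq: "y x = (\<chi> k. det (\<chi> i j. if j = k then b $ i else matrix (L x) $ i $ j) / det (matrix (L x)))"
    if "x \<in> S" for x
    using cramer[OF det[OF that], of "y x" b] sol[OF that] matrix_vector_mul(2)[OF lin[OF that]] by metis
  have "continuous_on S (\<lambda>x. \<chi> k. det (\<chi> i j. if j = k then b $ i else matrix (L x) $ i $ j) / det (matrix (L x)))"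
  proof (intro continuous_on_vec_lambda continuous_on_divide continuous_on_det ent)
    show "continuous_on S (\<lambda>x. (\<chi> i j. if j = k then b $ i else matrix (L x) $ i $ j) $ i $ j)" for k i j
      by (cases "j = k") (auto intro: ent)
  qed (auto simp: det)
  then show ?thesis
    using sol_eq by (simp cong: continuous_on_cong)
qed

text \<open>The map \<open>\<Psi>\<close> below joins the tangential part of the gradient to the normal part of the position;
  it is injective by strict monotonicity of the gradient, so invariance of domain applies to it, and
  \<open>Q\<close> is its inverse composed with the projection to \<open>T\<close>.\<close>

lemma constrained_entropy_grad_inverse:
  fixes q0 :: "real^'m"
  assumes T: "subspace T"
  obtains \<Omega> Q Q' where "open \<Omega>"
    "\<And>r. r \<in> \<Omega> \<Longrightarrow> Q r \<in> open_simplex c \<and> Q r - q0 \<in> T \<and> r - entropy_grad c (Q r) \<in> T\<^sup>\<bottom>"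
    "\<And>r q. \<lbrakk>q \<in> open_simplex c; q - q0 \<in> T; r - entropy_grad c q \<in> T\<^sup>\<bottom>\<rbrakk> \<Longrightarrow> r \<in> \<Omega> \<and> Q r = q"
    "\<And>r. r \<in> \<Omega> \<Longrightarrow> (Q has_derivative Q' r) (at r)"
    "\<And>r v. r \<in> \<Omega> \<Longrightarrow> Q' r v \<in> T"
    "\<And>v. continuous_on \<Omega> (\<lambda>r. Q' r v)"
proof -
  obtain \<pi> :: "real^'m \<Rightarrow> real^'m" where lin: "linear \<pi>" and \<pi>T: "\<And>v. \<pi> v \<in> T"
    and orth: "\<And>u v. u \<in> T \<Longrightarrow> u \<bullet> (v - \<pi> v) = 0"
    and id: "\<And>v. v \<in> T \<Longrightarrow> \<pi> v = v" and perp: "\<And>v. v \<in> T\<^sup>\<bottom> \<Longrightarrow> \<pi> v = 0"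
    using obtain_orthogonal_projection[OF T] by metis
  let ?D = "open_simplex c :: (real^'m) set"
  have blin: "bounded_linear \<pi>"
    using lin by (simp add: linear_conv_bounded_linear)
  \<comment> \<open>\<open>b - \<pi> b\<close> is the component of \<open>b\<close> normal to
    \<open>T\<close>, and the splitting into tangential and normal parts is unique.\<close>
  have split: "a = a' \<and> b - \<pi> b = b' - \<pi> b'"
    if "a \<in> T" "a' \<in> T" "a + (b - \<pi> b) = a' + (b' - \<pi> b')" for a a' b b'
  proof -
    have "\<pi> (a + (b - \<pi> b)) = a" if "a \<in> T" for a b
      using id[OF \<pi>T] id[OF that] by (simp add: linear_add[OF lin] linear_diff[OF lin])
    then have "\<pi> (a + (b - \<pi> b)) = a" "\<pi> (a' + (b' - \<pi> b')) = a'"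
      using that(1,2) by blast+
    then have "a = a'" using that(3) by metis
    then show ?thesis using that(3) by auto
  qed
  have memT: "b \<in> T" if "b - \<pi> b = 0" for b
    using that \<pi>T[of b] by simp
  define \<Psi> where "\<Psi> x = \<pi> (entropy_grad c x) + ((x - q0) - \<pi> (x - q0))" for x
  define \<Psi>' where "\<Psi>' x v = \<pi> (entropy_hess c x v) + (v - \<pi> v)" for x v
  have inj: "inj_on \<Psi> ?D"
  proof (rule inj_onI)
    fix x y assume x: "x \<in> ?D" and y: "y \<in> ?D" and eq: "\<Psi> x = \<Psi> y"
    from split[OF \<pi>T \<pi>T eq[unfolded \<Psi>_def]]
    have 1: "\<pi> (entropy_grad c x - entropy_grad c y) = 0" and 2: "(x - y) - \<pi> (x - y) = 0"
      by (auto simp: linear_diff[OF lin] algebra_simps)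
    \<comment> \<open>\<open>x - y\<close> is tangential and the difference of the gradients is
      normal to \<open>T\<close>, so their pairing vanishes.\<close>
    have "(x - y) \<bullet> (entropy_grad c x - entropy_grad c y) = 0"
      using orth[OF memT[OF 2], of "entropy_grad c x - entropy_grad c y"] 1 by simp
    then show "x = y"
      using entropy_grad_strict_mono[OF x y] by fastforce
  qed
  have der: "(\<Psi> has_derivative \<Psi>' x) (at x)" if "x \<in> ?D" for x
    unfolding \<Psi>_def[abs_def] \<Psi>'_def[abs_def]
    by (rule derivative_eq_intros bounded_linear.has_derivative[OF blin]
        has_derivative_entropy_grad[OF that] refl | simp)+
  have lin': "linear (\<Psi>' x)" if "x \<in> ?D" for x
    using der[OF that] has_derivative_linear by blast
  \<comment> \<open>The infinitesimal form of the same argument: positivity of the Hessian replaces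
    monotonicity.\<close>
  have inj': "inj (\<Psi>' x)" if "x \<in> ?D" for x
  proof (subst linear_injective_0[OF lin'[OF that]], intro allI impI)
    fix v assume "\<Psi>' x v = 0"
    then have "\<pi> (entropy_hess c x v) + (v - \<pi> v) = 0 + (0 - \<pi> 0)"
      by (simp add: \<Psi>'_def linear_0[OF lin])
    from split[OF \<pi>T subspace_0[OF T] this]
    have 1: "\<pi> (entropy_hess c x v) = 0" and 2: "v - \<pi> v = 0"
      by (auto simp: linear_0[OF lin])
    have "v \<bullet> entropy_hess c x v = 0"
      using orth[OF memT[OF 2], of "entropy_hess c x v"] 1 by simp
    then show "v = 0"
      using entropy_hess_pos[OF that, of v] by fastforce
  qed
  have cont: "continuous_on ?D \<Psi>"
    using der has_derivative_continuous by (blast intro: continuous_at_imp_continuous_on)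
  have openI: "open (\<Psi> ` ?D)"
    using invariance_of_domain[OF cont open_open_simplex inj] .
  obtain g where g: "homeomorphism ?D (\<Psi> ` ?D) \<Psi> g"
    using invariance_of_domain_homeomorphism[OF open_open_simplex cont _ inj] by blast
  then have gD: "g y \<in> ?D" and \<Psi>g: "\<Psi> (g y) = y" if "y \<in> \<Psi> ` ?D" for y
    using that by (auto simp: homeomorphism_def)
  have g\<Psi>: "g (\<Psi> x) = x" if "x \<in> ?D" for x
    using that g by (auto simp: homeomorphism_def)
  have "\<exists>h. linear h \<and> h \<circ> \<Psi>' x = id \<and> \<Psi>' x \<circ> h = id" if "x \<in> ?D" for x
    using linear_injective_isomorphism[OF lin'[OF that] inj'[OF that]] by (auto simp: fun_eq_iff)
  then obtain h where h: "\<And>x. x \<in> ?D \<Longrightarrow> linear (h x)" "\<And>x. x \<in> ?D \<Longrightarrow> h x \<circ> \<Psi>' x = id"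
      "\<And>x. x \<in> ?D \<Longrightarrow> \<Psi>' x \<circ> h x = id"
    by metis
  have gder: "(g has_derivative h (g y)) (at y)" if "y \<in> \<Psi> ` ?D" for y
  proof (rule has_derivative_inverse_basic[where f = \<Psi> and T = "\<Psi> ` ?D"])
    show "(\<Psi> has_derivative \<Psi>' (g y)) (at (g y))"
      using der gD[OF that] by blast
    show "bounded_linear (h (g y))"
      using h(1) gD[OF that] linear_conv_bounded_linear by blast
    show "h (g y) \<circ> \<Psi>' (g y) = id" using h(2) gD[OF that] by blast
    show "continuous (at y) g"
      using homeomorphism_cont2[OF g] openI that by (simp add: continuous_on_eq_continuous_at del: ball_simps image_iff)
  qed (use openI that \<Psi>g in auto)
  define \<Omega> where "\<Omega> = \<pi> -` (\<Psi> ` ?D)"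
  define Q where "Q r = g (\<pi> r)" for r
  define Q' where "Q' r v = h (Q r) (\<pi> v)" for r v
  have QD: "Q r \<in> ?D" and \<Psi>Q: "\<Psi> (Q r) = \<pi> r" if "r \<in> \<Omega>" for r
    using that gD \<Psi>g by (auto simp: \<Omega>_def Q_def)
  \<comment> \<open>This linear system determines \<open>Q' r v\<close>. Its normal part shows that
    \<open>Q' r v\<close> is tangential, and Cramer's rule turns it into continuity in
    \<open>r\<close>.\<close>
  have \<Psi>Q': "\<Psi>' (Q r) (Q' r v) = \<pi> v" if "r \<in> \<Omega>" for r v
    using h(3)[OF QD[OF that]] by (auto simp: Q'_def fun_eq_iff)
  have Qder: "(Q has_derivative Q' r) (at r)" if "r \<in> \<Omega>" for r
    unfolding Q_def[abs_def] Q'_def[abs_def]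
    using that by (intro has_derivative_compose[OF bounded_linear_imp_has_derivative[OF blin] gder, unfolded o_def])
      (auto simp: \<Omega>_def)
  show thesis
  proof (rule that)
    show "open \<Omega>"
      unfolding \<Omega>_def using openI blin
      by (intro open_vimage) (auto intro: linear_continuous_on)
    show "(Q has_derivative Q' r) (at r)" if "r \<in> \<Omega>" for r
      by (fact Qder[OF that])
    show "Q r \<in> open_simplex c \<and> Q r - q0 \<in> T \<and> r - entropy_grad c (Q r) \<in> T\<^sup>\<bottom>" if "r \<in> \<Omega>" for r
    proof -
      have "\<pi> (entropy_grad c (Q r)) + ((Q r - q0) - \<pi> (Q r - q0)) = \<pi> r + (0 - \<pi> 0)"
        using \<Psi>Q[OF that] by (simp add: \<Psi>_def linear_0[OF lin])
      from split[OF \<pi>T \<pi>T this]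
      have 1: "\<pi> (r - entropy_grad c (Q r)) = 0" and 2: "(Q r - q0) - \<pi> (Q r - q0) = 0"
        by (simp_all only: linear_0[OF lin] linear_diff[OF lin]) simp_all
      have "r - entropy_grad c (Q r) \<in> T\<^sup>\<bottom>"
        using orth[of _ "r - entropy_grad c (Q r)"] 1 by (auto simp: orthogonal_comp_def orthogonal_def)
      with memT[OF 2] QD[OF that] show ?thesis by blast
    qed
    show "r \<in> \<Omega> \<and> Q r = q"
      if "q \<in> open_simplex c" "q - q0 \<in> T" "r - entropy_grad c q \<in> T\<^sup>\<bottom>" for r q
    proof -
      have "\<Psi> q = \<pi> r"
        using id[OF that(2)] perp[OF that(3)] by (simp add: \<Psi>_def linear_diff[OF lin])
      then show ?thesis
        using g\<Psi>[OF that(1)] that(1) by (auto simp: \<Omega>_def Q_def intro: image_eqI[of _ _ q])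
    qed
    show "Q' r v \<in> T" if "r \<in> \<Omega>" for r v
    proof -
      have "\<pi> (entropy_hess c (Q r) (Q' r v)) + (Q' r v - \<pi> (Q' r v)) = \<pi> v + (0 - \<pi> 0)"
        using \<Psi>Q'[OF that, of v] by (simp add: \<Psi>'_def linear_0[OF lin])
      from split[OF \<pi>T \<pi>T this] show ?thesis
        by (auto simp: linear_0[OF lin] intro: memT)
    qed
    show "continuous_on \<Omega> (\<lambda>r. Q' r v)" for v
    proof (rule continuous_on_linear_solve[where L = "\<lambda>r. \<Psi>' (Q r)" and b = "\<pi> v"])
      have contQ: "continuous_on \<Omega> Q"
        using Qder has_derivative_continuous by (blast intro: continuous_at_imp_continuous_on)
      have "continuous_on ?D (\<lambda>x. \<Psi>' x w)" for w
        unfolding \<Psi>'_def entropy_hess_def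
        by (intro continuous_intros linear_continuous_on_compose[OF _ lin])
          (auto simp: open_simplex_def less_imp_neq[THEN not_sym])
      from continuous_on_compose2[OF this contQ]
      show "continuous_on \<Omega> (\<lambda>r. \<Psi>' (Q r) w)" for w
        using QD by auto
    qed (use lin' inj' QD \<Psi>Q' in auto)
  qed
qed


section \<open>Faces of integral polytopes\<close>

text \<open>Compactness bounds the functional on \<open>P\<close>, so that the real-valued
  \<open>SUP\<close> in \<open>normal_cone\<close> has its intended meaning.\<close>

lemma normal_cone_iff:
  assumes "compact P" "x \<in> P"
  shows "u \<in> normal_cone P x \<longleftrightarrow> (\<forall>y\<in>P. u \<bullet> y \<le> u \<bullet> x)"
proof -
  have "bdd_above ((\<bullet>) u ` P)"
    using assms(1) by (intro bounded_imp_bdd_above compact_imp_bounded compact_continuous_image continuous_intros)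
  then have "u \<bullet> y \<le> (SUP y\<in>P. u \<bullet> y)" if "y \<in> P" for y
    using that by (rule cSUP_upper2) simp
  moreover have "(SUP y\<in>P. u \<bullet> y) = u \<bullet> x" if "\<forall>y\<in>P. u \<bullet> y \<le> u \<bullet> x"
    using that assms(2) by (intro cSup_eq_maximum) auto
  ultimately show ?thesis
    unfolding normal_cone_def by auto
qed

lemma inner_le_on_convex_hull:
  assumes "\<And>s. s \<in> S \<Longrightarrow> u \<bullet> s \<le> c" "y \<in> convex hull S"
  shows "u \<bullet> y \<le> c"
proof -
  have "convex hull S \<subseteq> {y. u \<bullet> y \<le> c}"
    using assms(1) by (intro hull_minimal convex_halfspace_le) auto
  then show ?thesis using assms(2) by auto
qed

lemma normal_cone_convex_hull_iff:
  assumes "finite S" "x \<in> convex hull S"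
  shows "u \<in> normal_cone (convex hull S) x \<longleftrightarrow> (\<forall>s\<in>S. u \<bullet> s \<le> u \<bullet> x)"
  using assms inner_le_on_convex_hull[of S u "u \<bullet> x"]
  by (subst normal_cone_iff) (auto simp: finite_imp_compact_convex_hull hull_inc)

lemma open_face_nonempty:
  assumes "F \<in> open_faces P"
  shows "F \<noteq> {}"
  using assms by (force simp: open_faces_def quotient_def)

lemma open_face_eq:
  assumes "F \<in> open_faces P" "x \<in> F"
  shows "F = {y \<in> P. normal_cone P y = normal_cone P x}"
  using assms by (auto simp: open_faces_def quotient_def)

lemma face_cone_eq:
  assumes "F \<in> open_faces P" "x \<in> F"
  shows "face_cone P F = normal_cone P x"
proof -
  have "(SOME x. x \<in> F) \<in> F"
    using assms(2) by (rule someI)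
  then show ?thesis
    using open_face_eq[OF assms] by (auto simp: face_cone_def)
qed

text \<open>\<open>A\<close> consists of the generators at which every functional of the cone of
  \<open>F\<close> attains its maximum over the polytope; \<open>F\<close> turns out to be the
  relative interior of the hull of \<open>A\<close>. The functional \<open>u0\<close>, strict at all
  other generators, later serves as a direction that pushes points into the interior of a
  region.\<close>

lemma open_face_convex_hull_decomposition:
  fixes S :: "(real^'m) set"
  assumes S: "finite S" and F: "F \<in> open_faces (convex hull S)"
  obtains A where "A \<subseteq> S"
    "\<And>q. q \<in> F \<Longrightarrow> \<exists>U. open U \<and> F = U \<inter> {x. x - q \<in> face_tangent F}"
    "face_tangent F = span {s - s' | s s'. s \<in> A \<and> s' \<in> A}"
    "\<And>u x. x \<in> F \<Longrightarrow> u \<in> face_cone (convex hull S) F \<longleftrightarrow>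
       u \<in> (face_tangent F)\<^sup>\<bottom> \<and> (\<forall>s\<in>S - A. u \<bullet> s \<le> u \<bullet> x)"
    "\<exists>u0\<in>(face_tangent F)\<^sup>\<bottom>. \<forall>x\<in>F. \<forall>s\<in>S - A. u0 \<bullet> s < u0 \<bullet> x"
proof -
  define P where "P = convex hull S"
  obtain q where q: "q \<in> F"
    using open_face_nonempty[OF F] by blast
  have Feq: "F = {y \<in> P. normal_cone P y = normal_cone P q}"
    using open_face_eq[OF F q] by (simp add: P_def)
  then have qP: "q \<in> P" using q by blast
  define C where "C = normal_cone P q"
  have fc: "face_cone P F = C"
    using face_cone_eq[OF F q] by (simp add: P_def C_def)
  have cone: "u \<in> normal_cone P x \<longleftrightarrow> (\<forall>s\<in>S. u \<bullet> s \<le> u \<bullet> x)" if "x \<in> P" for u x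
    using normal_cone_convex_hull_iff[OF S] that by (simp add: P_def)
  have Ciff: "u \<in> C \<longleftrightarrow> (\<forall>s\<in>S. u \<bullet> s \<le> u \<bullet> x)" if "x \<in> F" for u x
    using that cone Feq by (auto simp: C_def)
  define A where "A = {s \<in> S. \<forall>u\<in>C. u \<bullet> s = u \<bullet> q}"
  have AS: "A \<subseteq> S" by (auto simp: A_def)
  have finA: "finite A" using AS S finite_subset by blast
  have AP: "convex hull A \<subseteq> P" unfolding P_def by (rule hull_mono[OF AS])
  have CF: "u \<bullet> x = u \<bullet> q" if "u \<in> C" "x \<in> F" for u x
  proof (rule antisym)
    show "u \<bullet> x \<le> u \<bullet> q"
      using that Feq inner_le_on_convex_hull[of S u "u \<bullet> q" x] cone[OF qP] by (auto simp: P_def C_def)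
    show "u \<bullet> q \<le> u \<bullet> x"
      using that qP inner_le_on_convex_hull[of S u "u \<bullet> x" q] Ciff[OF that(2)] by (auto simp: P_def)
  qed
  have CA: "u \<bullet> y = u \<bullet> q" if "u \<in> C" "y \<in> convex hull A" for u y
  proof -
    have "convex hull A \<subseteq> {y. u \<bullet> y = u \<bullet> q}"
      using that(1) by (intro hull_minimal convex_hyperplane) (auto simp: A_def)
    then show ?thesis using that(2) by blast
  qed
  have F_hull: "F \<subseteq> convex hull A"
  proof
    fix x assume x: "x \<in> F"
    then have "x \<in> convex hull S" using Feq by (auto simp: P_def)
    then obtain l where l: "\<And>s. s \<in> S \<Longrightarrow> 0 \<le> l s" "sum l S = 1" "(\<Sum>s\<in>S. l s *\<^sub>R s) = x"
      by (auto simp: convex_hull_finite[OF S])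
    \<comment> \<open>Some functional of the cone is strictly below its maximum at \<open>s\<close>;
      a positive weight there would keep the average \<open>x\<close> from reaching the
      maximum.\<close>
    have "l s = 0" if s: "s \<in> S - A" for s
    proof -
      from s obtain u where u: "u \<in> C" "u \<bullet> s \<noteq> u \<bullet> q" by (auto simp: A_def)
      have le: "u \<bullet> s \<le> u \<bullet> q" if "s \<in> S" for s
        using Ciff[OF q] u(1) that by blast
      have "(\<Sum>s\<in>S. l s * (u \<bullet> q - u \<bullet> s)) = sum l S * (u \<bullet> q) - u \<bullet> (\<Sum>s\<in>S. l s *\<^sub>R s)"
        by (simp add: right_diff_distrib sum_subtractf inner_sum_right flip: sum_distrib_right)
      also have "\<dots> = 0"
        using l CF[OF u(1) x] by simp
      finally have "l s * (u \<bullet> q - u \<bullet> s) = 0"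
        using s l(1) le by (subst (asm) sum_nonneg_eq_0_iff[OF S]) auto
      then show ?thesis using u(2) by auto
    qed
    then have z: "l s = 0" if "s \<in> S" "s \<notin> A" for s using that by blast
    have "sum l A = 1" "(\<Sum>s\<in>A. l s *\<^sub>R s) = x"
      using l(2,3) z S AS by (auto simp: sum.mono_neutral_left[of S A])
    then show "x \<in> convex hull A"
      using l(1) AS by (auto simp: convex_hull_finite[OF finA])
  qed
  have ANE: "A \<noteq> {}" using q F_hull by auto
  have Csum: "(\<Sum>s\<in>B. f s) \<in> C" if "\<And>s. s \<in> B \<Longrightarrow> f s \<in> C" for B and f :: "_ \<Rightarrow> real^'m"
    using that unfolding Ciff[OF q] inner_sum_left by (auto intro!: sum_mono)
  \<comment> \<open>Each generator outside \<open>A\<close> has its own functional that is strict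
    there. Their sum stays in the cone and is strict at all of them.\<close>
  obtain u0 where u0: "u0 \<in> C" "\<And>s. s \<in> S - A \<Longrightarrow> u0 \<bullet> s < u0 \<bullet> q"
  proof -
    have "\<exists>u\<in>C. u \<bullet> s < u \<bullet> q" if "s \<in> S - A" for s
      using that Ciff[OF q] by (force simp: A_def less_le)
    then obtain f where f: "\<And>s. s \<in> S - A \<Longrightarrow> f s \<in> C \<and> f s \<bullet> s < f s \<bullet> q"
      by metis
    show thesis
    proof (rule that[of "\<Sum>s\<in>S - A. f s"])
      show "(\<Sum>s\<in>S - A. f s) \<in> C" using f by (intro Csum) auto
      show "(\<Sum>s\<in>S - A. f s) \<bullet> s < (\<Sum>s\<in>S - A. f s) \<bullet> q" if s: "s \<in> S - A" for s
        unfolding inner_sum_left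
      proof (rule sum_strict_mono_ex1)
        show "finite (S - A)" using S by simp
        show "\<forall>s'\<in>S - A. f s' \<bullet> s \<le> f s' \<bullet> q" using f s Ciff[OF q] by blast
        show "\<exists>s'\<in>S - A. f s' \<bullet> s < f s' \<bullet> q" using f s by blast
      qed
    qed
  qed
  \<comment> \<open>At a relative boundary point a supporting functional \<open>a\<close> is not
    constant on the hull of \<open>A\<close>. Corrected by a multiple of \<open>u0\<close>, its
    negative would lie in the cone, whose members are constant on that hull.\<close>
  have F_sub_ri: "x \<in> rel_interior (convex hull A)" if x: "x \<in> F" for x
  proof (rule ccontr)
    assume nri: "x \<notin> rel_interior (convex hull A)"
    have xA: "x \<in> convex hull A" using x F_hull by blast
    obtain a where a: "\<And>y. y \<in> convex hull A \<Longrightarrow> a \<bullet> x \<le> a \<bullet> y"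
        "\<And>y. y \<in> rel_interior (convex hull A) \<Longrightarrow> a \<bullet> x < a \<bullet> y"
      by (rule supporting_hyperplane_rel_boundary[OF convex_convex_hull xA nri]) blast
    obtain y where y: "y \<in> rel_interior (convex hull A)"
      using ANE rel_interior_eq_empty[of "convex hull A"] by auto
    then have yA: "y \<in> convex hull A" using rel_interior_subset by blast
    have CAx: "u \<bullet> y = u \<bullet> x" if "u \<in> C" "y \<in> convex hull A" for u y
      using CA[OF that] CF[OF that(1) x] by simp
    \<comment> \<open>A large multiple of \<open>u0\<close> compensates \<open>- a\<close> outside \<open>A\<close> and is constant on \<open>A\<close>.\<close>
    define K where "K = (\<Sum>s\<in>S - A. \<bar>a \<bullet> (x - s)\<bar> / (u0 \<bullet> (x - s)))"
    have pos: "0 < u0 \<bullet> (x - s)" if "s \<in> S - A" for s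
      using u0(2)[OF that] CF[OF u0(1) x] by (simp add: inner_diff_right)
    have KC: "K *\<^sub>R u0 - a \<in> C"
      unfolding Ciff[OF x]
    proof
      fix s assume s: "s \<in> S"
      show "(K *\<^sub>R u0 - a) \<bullet> s \<le> (K *\<^sub>R u0 - a) \<bullet> x"
      proof (cases "s \<in> A")
        case True
        then show ?thesis
          using a(1)[of s] CAx[OF u0(1), of s] by (simp add: hull_inc inner_diff_left)
      next
        case False
        have "\<bar>a \<bullet> (x - s)\<bar> / (u0 \<bullet> (x - s)) \<le> K"
          unfolding K_def using s False S pos
          by (intro member_le_sum[of s "S - A" "\<lambda>s. \<bar>a \<bullet> (x - s)\<bar> / (u0 \<bullet> (x - s))"])
            (auto intro!: divide_nonneg_pos)
        then have "\<bar>a \<bullet> (x - s)\<bar> \<le> K * (u0 \<bullet> (x - s))"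
          using pos[of s] s False by (simp add: pos_divide_le_eq)
        then show ?thesis
          by (simp add: inner_diff_left inner_diff_right algebra_simps)
      qed
    qed
    show False
      using a(2)[OF y] CAx[OF KC yA] CAx[OF u0(1) yA] by (simp add: inner_diff_left)
  qed
  have F_ri: "F = rel_interior (convex hull A)"
  proof
    show "F \<subseteq> rel_interior (convex hull A)"
      using F_sub_ri by blast
    show "rel_interior (convex hull A) \<subseteq> F"
    proof
      fix x assume x: "x \<in> rel_interior (convex hull A)"
      then have xA: "x \<in> convex hull A" using rel_interior_subset by blast
      then have xP: "x \<in> P" using AP by blast
      have "normal_cone P x = C"
      proof (intro set_eqI iffI)
        fix u assume "u \<in> C"
        then show "u \<in> normal_cone P x"
          using CA[OF _ xA] Ciff[OF q] by (simp add: cone[OF xP])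
      next
        fix u assume u: "u \<in> normal_cone P x"
        have le: "u \<bullet> y \<le> u \<bullet> x" if "y \<in> convex hull S" for y
          using u inner_le_on_convex_hull[OF _ that, of u "u \<bullet> x"] by (simp add: cone[OF xP])
        \<comment> \<open>The segment from \<open>q\<close> to \<open>x\<close> can be prolonged
          past \<open>x\<close> inside the hull; as \<open>u\<close> is maximal at \<open>x\<close>,
          it cannot be smaller at \<open>q\<close>.\<close>
        obtain e where e: "e > 1" "(1 - e) *\<^sub>R q + e *\<^sub>R x \<in> convex hull A"
          using convex_rel_interior_if2[OF convex_convex_hull x] q F_hull hull_subset[of "convex hull A" affine] by blast
        have "u \<bullet> ((1 - e) *\<^sub>R q + e *\<^sub>R x) \<le> u \<bullet> x"
          using e AP by (intro le) (auto simp: P_def)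
        then have "(e - 1) * (u \<bullet> x) \<le> (e - 1) * (u \<bullet> q)"
          by (simp add: inner_add_right algebra_simps)
        then have "u \<bullet> x \<le> u \<bullet> q" using e(1) by simp
        then show "u \<in> C"
          using u Ciff[OF q] by (force simp: cone[OF xP])
      qed
      then show "x \<in> F" using Feq xP by (simp add: C_def)
    qed
  qed
  define D where "D = {s - s' | s s'. s \<in> A \<and> s' \<in> A}"
  obtain a0 where a0: "a0 \<in> A" using ANE by blast
  have hull_D: "x - a0 \<in> span D" if "x \<in> convex hull A" for x
  proof -
    have "convex ((+) a0 ` span D)"
      by (intro convex_translation subspace_imp_convex subspace_span)
    moreover have "s \<in> (+) a0 ` span D" if "s \<in> A" for s
      using that a0 by (intro image_eqI[of _ _ "s - a0"] span_base) (auto simp: D_def)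
    ultimately have "convex hull A \<subseteq> (+) a0 ` span D"
      by (intro hull_minimal) auto
    then show ?thesis using that by auto
  qed
  have tangent: "face_tangent F = span D"
    unfolding face_tangent_def
  proof (rule antisym; rule span_minimal[OF _ subspace_span])
    show "{x - y |x y. x \<in> F \<and> y \<in> F} \<subseteq> span D"
    proof clarify
      fix x y assume "x \<in> F" "y \<in> F"
      then have "(x - a0) - (y - a0) \<in> span D"
        using F_hull by (intro span_diff hull_D) auto
      then show "x - y \<in> span D" by simp
    qed
    have qs: "s - q \<in> span {x - y |x y. x \<in> F \<and> y \<in> F}" if "s \<in> A" for s
    proof -
      \<comment> \<open>The midpoint of \<open>s\<close> and \<open>q\<close> lies in
        \<open>F\<close> because \<open>q\<close> is a relative interior point; so
        \<open>s - q\<close> is twice a difference of points of \<open>F\<close>.\<close>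
      have "s - (1/2) *\<^sub>R (s - q) \<in> F"
        unfolding F_ri using that F_sub_ri[OF q]
        by (intro rel_interior_convex_shrink) (auto intro: hull_inc)
      then have "(s - (1/2) *\<^sub>R (s - q)) - q \<in> span {x - y |x y. x \<in> F \<and> y \<in> F}"
        using q by (intro span_base) blast
      from span_scale[OF this, of 2]
      have "2 *\<^sub>R ((s - (1/2) *\<^sub>R (s - q)) - q) \<in> span {x - y |x y. x \<in> F \<and> y \<in> F}" .
      moreover have "2 *\<^sub>R ((s - (1/2) *\<^sub>R (s - q)) - q) = s - q"
        by (simp add: algebra_simps scaleR_2)
      ultimately show ?thesis by metis
    qed
    show "D \<subseteq> span {x - y |x y. x \<in> F \<and> y \<in> F}"
    proof (clarsimp simp: D_def)
      fix s s' assume "s \<in> A" "s' \<in> A"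
      then have "(s - q) - (s' - q) \<in> span {x - y |x y. x \<in> F \<and> y \<in> F}"
        by (intro span_diff qs)
      then show "s - s' \<in> span {x - y |x y. x \<in> F \<and> y \<in> F}" by simp
    qed
  qed
  have C_perp: "u \<in> (span D)\<^sup>\<bottom>" if "u \<in> C" for u
  proof -
    have "orthogonal u d" if "d \<in> D" for d
      using that \<open>u \<in> C\<close> by (auto simp: D_def A_def orthogonal_def inner_diff_right)
    then have "orthogonal u y" if "y \<in> span D" for y
      using that orthogonal_to_span by blast
    then show ?thesis
      by (auto simp: orthogonal_comp_def orthogonal_commute)
  qed
  have cone_iff: "u \<in> C \<longleftrightarrow> u \<in> (span D)\<^sup>\<bottom> \<and> (\<forall>s\<in>S - A. u \<bullet> s \<le> u \<bullet> x)" if x: "x \<in> F" for u x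
  proof (intro iffI conjI)
    assume u: "u \<in> (span D)\<^sup>\<bottom> \<and> (\<forall>s\<in>S - A. u \<bullet> s \<le> u \<bullet> x)"
    \<comment> \<open>Orthogonality to the differences of \<open>A\<close> makes \<open>u\<close>
      constant on the hull of \<open>A\<close>, so only the inequalities at the other generators
      carry information.\<close>
    have "u \<bullet> s = u \<bullet> x" if "s \<in> A" for s
    proof -
      have "(s - a0) - (x - a0) \<in> span D"
        using x F_hull that by (intro span_diff hull_D) (auto intro: hull_inc)
      then have "u \<bullet> (s - x) = 0"
        using u by (auto simp: orthogonal_comp_def orthogonal_def inner_commute)
      then show ?thesis by (simp add: inner_diff_right)
    qed
    then show "u \<in> C" using u by (force simp: Ciff[OF x])
  qed (use C_perp Ciff[OF x] in auto)
  show thesis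
  proof (rule that[OF AS])
    show "\<exists>U. open U \<and> F = U \<inter> {x. x - q \<in> face_tangent F}" if q: "q \<in> F" for q
    proof -
      obtain U where U: "open U" "F = affine hull (convex hull A) \<inter> U"
        using openin_rel_interior[of "convex hull A"] by (auto simp: F_ri openin_open)
      let ?H = "affine hull (convex hull A)"
      \<comment> \<open>The affine hull recentred at \<open>q\<close> is a linear subspace. It
        contains all differences of points of \<open>F\<close>, so tangential moves from
        \<open>q\<close> stay in the affine hull.\<close>
      have sub: "subspace {v. q + v \<in> ?H}"
      proof -
        have "subspace ((\<lambda>x. - q + x) ` ?H)"
          using q U by (intro affine_diffs_subspace) (auto simp: affine_affine_hull)
        moreover have "(\<lambda>x. - q + x) ` ?H = {v. q + v \<in> ?H}"
          by (auto intro!: image_eqI[of _ _ "q + _"])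
        ultimately show ?thesis by simp
      qed
      have "face_tangent F \<subseteq> {v. q + v \<in> ?H}"
        unfolding face_tangent_def
      proof (intro span_minimal sub subsetI, clarify)
        fix x y assume "x \<in> F" "y \<in> F"
        then have "x - q \<in> {v. q + v \<in> ?H}" "y - q \<in> {v. q + v \<in> ?H}"
          using U by auto
        then have "(x - q) - (y - q) \<in> {v. q + v \<in> ?H}"
          by (rule subspace_diff[OF sub])
        then show "q + (x - y) \<in> ?H" by simp
      qed
      then have "x \<in> ?H" if "x - q \<in> face_tangent F" for x
        using that by force
      moreover have "x - q \<in> face_tangent F" if "x \<in> F" for x
        unfolding face_tangent_def using that q by (intro span_base) blast
      ultimately show ?thesis using U by blast
    qed
    show "face_tangent F = span {s - s' |s s'. s \<in> A \<and> s' \<in> A}"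
      using tangent by (simp add: D_def)
    show "u \<in> face_cone (convex hull S) F \<longleftrightarrow>
        u \<in> (face_tangent F)\<^sup>\<bottom> \<and> (\<forall>s\<in>S - A. u \<bullet> s \<le> u \<bullet> x)" if "x \<in> F" for u x
      using cone_iff[OF that] tangent fc by (simp add: P_def)
    show "\<exists>u0\<in>(face_tangent F)\<^sup>\<bottom>. \<forall>x\<in>F. \<forall>s\<in>S - A. u0 \<bullet> s < u0 \<bullet> x"
      using C_perp[OF u0(1)] u0 CF[OF u0(1)] by (intro bexI[of _ u0]) (auto simp: tangent)
  qed
qed


section \<open>Logarithmic coordinates on the torus\<close>

text \<open>With the factor 2, \<open>exp (r $ j)\<close> is the squared modulus of
  \<open>z $ j\<close>, and the flow by half of \<open>\<tau>\<close> translates \<open>r\<close> by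
  exactly \<open>\<tau>\<close>.\<close>

definition log_coord :: "complex^'m \<Rightarrow> real^'m" where
  "log_coord z = (\<chi> j. 2 * ln (norm (z $ j)))"

lemma open_torus: "open (torus :: (complex^'m) set)"
proof -
  have torus_eq: "torus = (\<Inter>j. {z :: complex^'m. z $ j \<noteq> 0})"
    by (auto simp: torus_def)
  show ?thesis
    unfolding torus_eq by (intro open_INT finite ballI open_Collect_neq continuous_intros)
qed

lemma exp_act_in_torus [simp]: "exp_act \<eta> z \<in> torus \<longleftrightarrow> z \<in> torus"
  by (simp add: torus_def exp_act_def)

lemma exp_act_exp_act: "exp_act \<eta> (exp_act \<zeta> z) = exp_act (\<eta> + \<zeta>) z"
  by (simp add: exp_act_def vec_eq_iff exp_add mult_ac)

lemma exp_act_0 [simp]: "exp_act 0 z = z"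
  by (simp add: exp_act_def vec_eq_iff)

lemma cvec_add: "cvec (x + y) = cvec x + cvec y"
  by (simp add: cvec_def vec_eq_iff)

lemma cvec_0 [simp]: "cvec 0 = 0"
  by (simp add: cvec_def vec_eq_iff)

lemma log_coord_exp_act:
  assumes "z \<in> torus"
  shows "log_coord (exp_act \<eta> z) = log_coord z + 2 *\<^sub>R (\<chi> j. Re (\<eta> $ j))"
  using assms by (simp add: log_coord_def exp_act_def torus_def vec_eq_iff norm_mult ln_mult)

lemma log_coord_exp_act_cvec:
  assumes "z \<in> torus"
  shows "log_coord (exp_act (cvec \<tau>) z) = log_coord z + 2 *\<^sub>R \<tau>"
  using assms by (simp add: log_coord_exp_act cvec_def vec_eq_iff)

lemma norm_vec_power2: "(norm (z :: complex^'m))\<^sup>2 = (\<Sum>j\<in>UNIV. (norm (z $ j))\<^sup>2)"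
  by (simp add: norm_vec_def L2_set_def sum_nonneg)

lemma sum_moment_map:
  "1 - (\<Sum>j\<in>UNIV. moment_map z $ j) = 1 / (1 + (norm (z :: complex^'m))\<^sup>2)"
proof -
  have "1 + (norm z)\<^sup>2 \<noteq> 0"
    using zero_le_power2[of "norm z"] by linarith
  then show ?thesis
    by (simp add: moment_map_def norm_vec_power2 field_simps flip: sum_divide_distrib)
qed

lemma moment_map_in_open_simplex:
  assumes "z \<in> torus" "0 < c"
  shows "c *\<^sub>R moment_map z \<in> open_simplex c"
proof -
  have pos: "0 < 1 + (norm z)\<^sup>2"
    by (simp add: add_pos_nonneg)
  have "c - (\<Sum>j\<in>UNIV. (c *\<^sub>R moment_map z) $ j) = c * (1 - (\<Sum>j\<in>UNIV. moment_map z $ j))"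
    by (simp add: right_diff_distrib flip: sum_distrib_left)
  also have "\<dots> > 0"
    using assms pos by (simp add: sum_moment_map)
  finally show ?thesis
    using assms pos by (auto simp: open_simplex_def moment_map_def torus_def)
qed

text \<open>A coordinate of the moment map divided by the slack is the squared modulus of
  \<open>z $ j\<close>. Thus the entropy gradient inverts the scaled moment map in logarithmic
  coordinates.\<close>

lemma entropy_grad_moment_map:
  assumes "z \<in> torus" "0 < c"
  shows "entropy_grad c (c *\<^sub>R moment_map z) = log_coord z"
proof -
  have pos: "0 < 1 + (norm z)\<^sup>2"
    by (simp add: add_pos_nonneg)
  have sum: "c - (\<Sum>j\<in>UNIV. (c *\<^sub>R moment_map z) $ j) = c / (1 + (norm z)\<^sup>2)"
    using arg_cong[OF sum_moment_map[of z], of "(*) c"]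
    by (simp add: right_diff_distrib flip: sum_distrib_left)
  show ?thesis
    using assms pos unfolding entropy_grad_def sum
    by (auto simp: vec_eq_iff moment_map_def log_coord_def torus_def ln_div ln_mult ln_realpow)
qed

lemma entropy_grad_eq_log_coord_iff:
  assumes "z \<in> torus" "0 < c" "x \<in> open_simplex c"
  shows "entropy_grad c x = log_coord z \<longleftrightarrow> x = c *\<^sub>R moment_map z"
  using entropy_grad_strict_mono[OF assms(3) moment_map_in_open_simplex[OF assms(1,2)]]
    entropy_grad_moment_map[OF assms(1,2)] by fastforce

text \<open>Locally the logarithm of the modulus is the real part of a holomorphic logarithm, whose
  differential is \<open>v $ j / z $ j\<close>.\<close>

lemma has_derivative_log_coord:
  assumes "z \<in> torus"
  shows "(log_coord has_derivative (\<lambda>v. \<chi> j. 2 * Re (v $ j / z $ j))) (at z)"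
proof -
  have Re_divide_eq: "Re (v / w) = inverse (norm w) * (v \<bullet> sgn w)" for v w :: complex
  proof -
    have "Re (v / w) = (v \<bullet> w) / (norm w)\<^sup>2"
      by (simp add: Re_divide inner_complex_def cmod_power2)
    then show ?thesis
      by (simp add: sgn_div_norm power2_eq_square divide_inverse)
  qed
  have "((\<lambda>y. log_coord y $ j) has_derivative (\<lambda>v. (\<chi> j. 2 * Re (v $ j / z $ j)) $ j)) (at z)" for j
  proof -
    have nz: "z $ j \<noteq> 0" using assms by (simp add: torus_def)
    have "((\<lambda>y. norm (y $ j)) has_derivative (\<lambda>v. v $ j \<bullet> sgn (z $ j))) (at z)"
      using has_derivative_compose[OF bounded_linear_imp_has_derivative[OF bounded_linear_vec_nth]
          has_derivative_norm[OF nz]] .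
    then show ?thesis
      unfolding log_coord_def[abs_def] vec_lambda_beta Re_divide_eq
      by (auto intro!: derivative_eq_intros simp: nz)
  qed
  then show ?thesis
    by (subst has_derivative_componentwise_within) (auto simp: Basis_vec_def inner_axis)
qed

section \<open>Complex Hessians of functions of the logarithmic coordinates\<close>

lemma log_coord_derivative_axis:
  "(\<chi> i. 2 * Re (axis j a $ i / z $ i)) = (2 * Re (a / z $ j)) *\<^sub>R (axis j 1 :: real^'m)"
  by (simp add: vec_eq_iff axis_def)

text \<open>With \<open>a = 1 / u\<close>, the real part of \<open>\<i> * a\<close> is minus the
  imaginary part of \<open>a\<close>, so the two combinations recover \<open>cnj a\<close> and
  \<open>a\<close>.\<close>

lemma Re_wirtinger:
  fixes u :: complex
  shows "Re (1 / u) + \<i> * Re (\<i> / u) = 1 / cnj u" "Re (1 / u) - \<i> * Re (\<i> / u) = 1 / u"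
proof -
  obtain a where a: "a = 1 / u" by simp
  then have "\<i> / u = \<i> * a" "1 / cnj u = cnj a" by simp_all
  with a show "Re (1 / u) + \<i> * Re (\<i> / u) = 1 / cnj u" "Re (1 / u) - \<i> * Re (\<i> / u) = 1 / u"
    by (simp_all only: flip: a) (simp_all add: complex_eq_iff)
qed

text \<open>The chain rule: the Wirtinger derivatives of the j-th logarithmic coordinate are
  \<open>1 / z $ j\<close> and its conjugate. The gradient \<open>G\<close> is required on an open
  set since it is differentiated again, the derivative \<open>G'\<close> only at
  \<open>w\<close>.\<close>

lemma ddbar_of_log_coord:
  fixes g :: "real^'m \<Rightarrow> real" and G :: "real^'m \<Rightarrow> real^'m"
  assumes V: "open V" "V \<subseteq> torus" "w \<in> V"
    and f: "\<And>z. z \<in> V \<Longrightarrow> f z = g (log_coord z)"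
    and g: "\<And>z. z \<in> V \<Longrightarrow> (g has_derivative (\<lambda>v. G (log_coord z) \<bullet> v)) (at (log_coord z))"
    and G: "(G has_derivative G') (at (log_coord w))"
  shows "ddbar f w = (\<chi> j k. \<i> / (2 * complex_of_real pi) *
    (complex_of_real (G' (axis j 1) $ k) / (w $ j * cnj (w $ k))))"
proof -
  have bar: "wirtinger_bar k (\<lambda>w. complex_of_real (f w)) z = complex_of_real (G (log_coord z) $ k) / cnj (z $ k)"
    if z: "z \<in> V" for z k
  proof -
    have zt: "z \<in> torus" and nz: "z $ k \<noteq> 0" using z V by (auto simp: torus_def)
    have "((\<lambda>w. complex_of_real (g (log_coord w))) has_derivative
        (\<lambda>v. complex_of_real (G (log_coord z) \<bullet> (\<chi> j. 2 * Re (v $ j / z $ j))))) (at z)"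
      by (rule has_derivative_of_real has_derivative_compose[OF has_derivative_log_coord[OF zt] g[OF z]])+
    then have "((\<lambda>w. complex_of_real (f w)) has_derivative
        (\<lambda>v. complex_of_real (G (log_coord z) \<bullet> (\<chi> j. 2 * Re (v $ j / z $ j))))) (at z)"
      by (rule has_derivative_transform_within_open[OF _ V(1) z]) (simp add: f)
    from frechet_derivative_at[OF this, symmetric]
    have "wirtinger_bar k (\<lambda>w. complex_of_real (f w)) z
        = complex_of_real (G (log_coord z) $ k) * (Re (1 / z $ k) + \<i> * Re (\<i> / z $ k))"
      unfolding wirtinger_bar_def by (simp add: log_coord_derivative_axis inner_axis field_simps)
    then show ?thesis by (simp add: Re_wirtinger)
  qed
  have "wirtinger j (wirtinger_bar k (\<lambda>w. complex_of_real (f w))) w =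
      complex_of_real (G' (axis j 1) $ k) / (w $ j * cnj (w $ k))" for j k
  proof -
    have wt: "w \<in> torus" and nz: "w $ j \<noteq> 0" "w $ k \<noteq> 0" using V by (auto simp: torus_def)
    have lin: "linear G'" using G by (rule has_derivative_linear)
    let ?D = "\<lambda>v :: complex^'m. complex_of_real (G' (\<chi> i. 2 * Re (v $ i / w $ i)) $ k) / cnj (w $ k)
      - complex_of_real (G (log_coord w) $ k) * cnj (v $ k) / (cnj (w $ k))\<^sup>2"
    have 1: "((\<lambda>z. complex_of_real (G (log_coord z) $ k)) has_derivative
        (\<lambda>v. complex_of_real (G' (\<chi> i. 2 * Re (v $ i / w $ i)) $ k))) (at w)"
      by (rule has_derivative_of_real bounded_linear.has_derivative[OF bounded_linear_vec_nth]
          has_derivative_compose[OF has_derivative_log_coord[OF wt] G])+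
    have 2: "((\<lambda>z. cnj (z $ k)) has_derivative (\<lambda>v. cnj (v $ k))) (at w)"
      by (rule bounded_linear.has_derivative[OF bounded_linear_cnj]
          bounded_linear_imp_has_derivative bounded_linear_vec_nth)+
    have "((\<lambda>z. complex_of_real (G (log_coord z) $ k) / cnj (z $ k)) has_derivative ?D) (at w)"
      by (rule has_derivative_eq_rhs[OF has_derivative_divide[OF 1 2]])
        (use nz in \<open>auto simp: fun_eq_iff field_simps power2_eq_square\<close>)
    then have "(wirtinger_bar k (\<lambda>w. complex_of_real (f w)) has_derivative ?D) (at w)"
      by (rule has_derivative_transform_within_open[OF _ V(1,3)]) (simp add: bar)
    from frechet_derivative_at[OF this, symmetric]
    have "wirtinger j (wirtinger_bar k (\<lambda>w. complex_of_real (f w))) w = (?D (axis j 1) - \<i> * ?D (axis j \<i>)) / 2"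
      unfolding wirtinger_def by simp
    \<comment> \<open>The factor \<open>1 / cnj (w $ k)\<close> is antiholomorphic, so
      differentiating it contributes nothing, even for \<open>j = k\<close>.\<close>
    also have "\<dots> = complex_of_real (G' (axis j 1) $ k) / cnj (w $ k) * (Re (1 / w $ j) - \<i> * Re (\<i> / w $ j))"
      unfolding log_coord_derivative_axis linear_scale[OF lin]
      using nz by (cases "j = k") (simp_all add: axis_def field_simps)
    finally show ?thesis by (simp add: Re_wirtinger mult_ac)
  qed
  then show ?thesis
    by (simp add: ddbar_def vec_eq_iff)
qed

definition log_partition :: "real^'m \<Rightarrow> real" where
  "log_partition r = ln (1 + (\<Sum>j\<in>UNIV. exp (r $ j)))"

definition log_partition_grad :: "real^'m \<Rightarrow> real^'m" where
  "log_partition_grad r = (\<chi> j. exp (r $ j) / (1 + (\<Sum>j\<in>UNIV. exp (r $ j))))"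

lemma log_partition_log_coord:
  "z \<in> torus \<Longrightarrow> log_partition (log_coord z) = ln (1 + (norm z)\<^sup>2)"
  by (simp add: log_partition_def log_coord_def norm_vec_power2 torus_def exp_double)

lemma has_derivative_log_partition:
  "(log_partition has_derivative (\<lambda>v. log_partition_grad r \<bullet> v)) (at r)"
proof -
  have pos: "0 < 1 + (\<Sum>j\<in>UNIV. exp (r $ j))"
    by (simp add: add_pos_nonneg sum_nonneg)
  show ?thesis
    unfolding log_partition_def[abs_def]
    by (rule derivative_eq_intros bounded_linear.has_derivative[OF bounded_linear_vec_nth] refl pos)+
      (simp add: fun_eq_iff inner_vec_def log_partition_grad_def sum_distrib_left
        sum_distrib_right divide_inverse mult_ac)
qed

text \<open>The derivative can stay implicit: it occurs both in the Fubini-Study form and in the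
  Hessian of \<open>decay_fun\<close>, and cancels in their difference.\<close>

lemma log_partition_grad_differentiable:
  "log_partition_grad differentiable (at (r :: real^'m))"
proof -
  have "1 + (\<Sum>j\<in>UNIV. exp (r $ j)) \<noteq> 0"
    by (metis add_pos_nonneg exp_ge_zero less_irrefl sum_nonneg zero_less_one)
  moreover have "(\<lambda>r :: real^'m. r $ j) differentiable (at r)" for j
    by (rule linear_imp_differentiable) (simp add: linear_iff)
  moreover have "(\<lambda>r :: real^'m. exp (r $ j)) differentiable (at r)" for j
    unfolding differentiable_def
    by (rule exI) (rule derivative_eq_intros bounded_linear.has_derivative[OF bounded_linear_vec_nth] refl)+
  ultimately have "(\<lambda>r. log_partition_grad r $ j) differentiable (at r)" for j
    unfolding log_partition_grad_def vec_lambda_beta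
    by (intro differentiable_divide differentiable_add differentiable_sum differentiable_const) auto
  then show ?thesis
    by (subst differentiable_componentwise_within) (auto simp: Basis_vec_def inner_axis)
qed


section \<open>The flow data and the regions\<close>

text \<open>Adding the two normal cone inequalities gives the opposite of strict monotonicity of the
  gradient. This is the uniqueness of \<open>q(z)\<close>.\<close>

lemma flow_unique:
  assumes "compact P" "q \<in> P" "q' \<in> P" "q \<in> open_simplex c" "q' \<in> open_simplex c"
    and "r - entropy_grad c q \<in> normal_cone P q" "r - entropy_grad c q' \<in> normal_cone P q'"
  shows "q = q'"
proof (rule ccontr)
  assume "q \<noteq> q'"
  then have "0 < (q - q') \<bullet> (entropy_grad c q - entropy_grad c q')"
    using entropy_grad_strict_mono assms by blast
  moreover have "(r - entropy_grad c q) \<bullet> q' \<le> (r - entropy_grad c q) \<bullet> q"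
      "(r - entropy_grad c q') \<bullet> q \<le> (r - entropy_grad c q') \<bullet> q'"
    using assms normal_cone_iff by blast+
  ultimately show False
    by (simp add: inner_diff_left inner_diff_right inner_commute algebra_simps)
qed

lemma normal_cone_scale:
  assumes "compact P" "q \<in> P" "\<tau> \<in> normal_cone P q" "0 \<le> a"
  shows "a *\<^sub>R \<tau> \<in> normal_cone P q"
  using assms by (auto simp: normal_cone_iff intro: mult_left_mono)

text \<open>The flow is a translation in logarithmic coordinates, so the equation defining the flow
  data becomes an additive decomposition of \<open>log_coord z\<close>.\<close>

lemma log_coord_pull_back:
  assumes z: "z \<in> torus" and c: "0 < c" and q: "q \<in> open_simplex c"
  shows "c *\<^sub>R moment_map (exp_act (cvec (- (1 / 2) *\<^sub>R \<tau>)) z) = q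
     \<longleftrightarrow> log_coord z = entropy_grad c q + \<tau>"
proof -
  have "log_coord (exp_act (cvec (- (1 / 2) *\<^sub>R \<tau>)) z) = log_coord z - \<tau>"
    using log_coord_exp_act_cvec[OF z] by simp
  then show ?thesis
    using entropy_grad_eq_log_coord_iff[of "exp_act (cvec (- (1 / 2) *\<^sub>R \<tau>)) z" c q] z c q by (auto simp: algebra_simps)
qed

text \<open>Flowing by \<open>\<tau>\<close> adds \<open>2 *\<^sub>R \<tau>\<close> to the
  logarithmic coordinates, and the cone absorbs the factor 2.\<close>

lemma region_iff:
  assumes P: "compact P" and F: "F \<in> open_faces P" and p: "0 < p"
  shows "z \<in> region P p F \<longleftrightarrow>
    z \<in> torus \<and> (\<exists>q\<in>F. q \<in> open_simplex (real p) \<and> log_coord z - entropy_grad (real p) q \<in> face_cone P F)"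
    (is "_ \<longleftrightarrow> ?R")
proof
  assume "z \<in> region P p F"
  then obtain \<tau> y where y: "y \<in> torus" "real p *\<^sub>R moment_map y \<in> F" "\<tau> \<in> face_cone P F"
      "z = exp_act (cvec \<tau>) y"
    by (auto simp: region_def)
  then have "real p *\<^sub>R moment_map y \<in> P"
    using open_face_eq[OF F y(2)] by blast
  then have "2 *\<^sub>R \<tau> \<in> face_cone P F"
    using y normal_cone_scale[OF P] face_cone_eq[OF F y(2)] by simp
  then show ?R
    using y p by (intro conjI bexI[of _ "real p *\<^sub>R moment_map y"])
      (simp_all add: moment_map_in_open_simplex log_coord_exp_act_cvec entropy_grad_moment_map)
next
  assume ?R
  then obtain q where z: "z \<in> torus" and q: "q \<in> F" "q \<in> open_simplex (real p)"
      "log_coord z - entropy_grad (real p) q \<in> face_cone P F"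
    by blast
  define \<tau> where "\<tau> = log_coord z - entropy_grad (real p) q"
  have qP: "q \<in> P" using open_face_eq[OF F q(1)] q(1) by blast
  let ?y = "exp_act (cvec (- (1 / 2) *\<^sub>R \<tau>)) z"
  have "real p *\<^sub>R moment_map ?y = q"
    using log_coord_pull_back[OF z _ q(2), of \<tau>] p by (simp add: \<tau>_def)
  moreover have "z = exp_act (cvec ((1 / 2) *\<^sub>R \<tau>)) ?y"
    by (simp add: exp_act_exp_act flip: cvec_add)
  moreover have "(1 / 2) *\<^sub>R \<tau> \<in> face_cone P F"
    using normal_cone_scale[OF P qP] q face_cone_eq[OF F q(1)] by (simp add: \<tau>_def)
  ultimately show "z \<in> region P p F"
    using z q(1) unfolding region_def mem_Collect_eq
    by (intro exI[of _ "(1 / 2) *\<^sub>R \<tau>"] exI[of _ ?y]) simp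
qed

text \<open>Two regions through \<open>z\<close> would share the point \<open>q(z)\<close>, and
  faces with a common point coincide.\<close>

lemma region_of_eq:
  assumes P: "compact P" and p: "0 < p"
    and F: "F \<in> open_faces P" "\<not> F \<subseteq> frontier (scaled_simplex p)" and z: "z \<in> region P p F"
  shows "region_of P p z = region P p F"
proof -
  have "F' = F" if F': "F' \<in> open_faces P" "z \<in> region P p F'" for F'
  proof -
    obtain q where q: "q \<in> F" "q \<in> open_simplex (real p)" "log_coord z - entropy_grad (real p) q \<in> face_cone P F"
      using z region_iff[OF P F(1) p] by blast
    obtain q' where q': "q' \<in> F'" "q' \<in> open_simplex (real p)" "log_coord z - entropy_grad (real p) q' \<in> face_cone P F'"
      using F' region_iff[OF P F'(1) p] by blast
    have "q = q'"
      using q q' flow_unique[OF P] face_cone_eq[OF F(1) q(1)] face_cone_eq[OF F'(1) q'(1)]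
        open_face_eq[OF F(1) q(1)] open_face_eq[OF F'(1) q'(1)] by blast
    then show ?thesis
      using open_face_eq[OF F(1) q(1)] open_face_eq[OF F'(1) q'(1)] by simp
  qed
  note uniq = this
  have "(THE F. F \<in> open_faces P \<and> \<not> F \<subseteq> frontier (scaled_simplex p) \<and> z \<in> region P p F) = F"
  proof (rule the_equality)
    show "F \<in> open_faces P \<and> \<not> F \<subseteq> frontier (scaled_simplex p) \<and> z \<in> region P p F"
      using F z by blast
  qed (use uniq in blast)
  then show ?thesis by (simp add: region_of_def)
qed

lemma flow_data_eq:
  assumes P: "compact P" and p: "0 < p" and z: "z \<in> torus" and q: "q \<in> P" "q \<in> open_simplex (real p)"
    and \<tau>: "log_coord z - entropy_grad (real p) q \<in> normal_cone P q"
  shows "flow_data P p z = (q, log_coord z - entropy_grad (real p) q)"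
  unfolding flow_data_def
proof (rule the_equality, goal_cases)
  case 1
  then show ?case
    using assms log_coord_pull_back[OF z _ q(2)] by simp
next
  case (2 d)
  obtain q' \<tau>' where d: "d = (q', \<tau>')" by (cases d)
  with 2 have *: "q' \<in> P" "\<tau>' \<in> normal_cone P q'"
      "real p *\<^sub>R moment_map (exp_act (cvec (- (1 / 2) *\<^sub>R \<tau>')) z) = q'"
    by auto
  then have q': "q' \<in> open_simplex (real p)"
    using moment_map_in_open_simplex[of "exp_act (cvec (- (1 / 2) *\<^sub>R \<tau>')) z" "real p"] z p by simp
  then have lc: "log_coord z = entropy_grad (real p) q' + \<tau>'"
    using log_coord_pull_back[OF z _ q', of \<tau>'] * p by simp
  then have "q = q'"
    using * lc by (intro flow_unique[OF P q(1) _ q(2) q' \<tau>]) auto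
  then show ?case using d lc by simp
qed

section \<open>The decay function as a Legendre transform\<close>

lemma inner_entropy_grad:
  assumes "x \<in> open_simplex c"
  shows "x \<bullet> entropy_grad c x = entropy c x - c * ln (c - (\<Sum>j\<in>UNIV. x $ j))"
  by (simp add: inner_vec_def entropy_grad_def entropy_def algebra_simps sum_subtractf
      flip: sum_distrib_left sum_distrib_right)

text \<open>The value of \<open>b\<^sub>P\<close>: up to a constant, the second summand is the Legendre transform
  \<open>max\<^sub>x\<^sub>\<in>\<^sub>P (\<langle>x, r\<rangle> - entropy x)\<close> at \<open>r = log_coord z\<close>, attained at \<open>x = q(z)\<close>.\<close>

lemma decay_fun_eq:
  assumes P: "compact P" and p: "0 < p" and z: "z \<in> torus" and q: "q \<in> P" "q \<in> open_simplex (real p)"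
    and \<tau>: "log_coord z - entropy_grad (real p) q \<in> normal_cone P q"
  shows "decay_fun P p z = real p * ln (1 + (norm z)\<^sup>2)
    - (q \<bullet> log_coord z - entropy (real p) q + real p * ln (real p))"
proof -
  define \<tau>' where "\<tau>' = log_coord z - entropy_grad (real p) q"
  define y where "y = exp_act (cvec (- (1 / 2) *\<^sub>R \<tau>')) z"
  define s where "s = real p - (\<Sum>j\<in>UNIV. q $ j)"
  have s: "0 < s" using q(2) by (simp add: s_def open_simplex_def)
  have "real p *\<^sub>R moment_map y = q"
    using log_coord_pull_back[OF z _ q(2), of \<tau>'] p by (simp add: y_def \<tau>'_def)
  then have "s = real p * (1 - (\<Sum>j\<in>UNIV. moment_map y $ j))"
    by (auto simp: s_def right_diff_distrib sum_distrib_left)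
  \<comment> \<open>The slack of the moment map at \<open>y\<close> is the reciprocal of
    \<open>1 + (norm y)\<^sup>2\<close>.\<close>
  then have "1 + (norm y)\<^sup>2 = real p / s"
    using p s by (simp add: sum_moment_map)
  moreover have "0 < 1 + (norm z)\<^sup>2"
    by (simp add: add_pos_nonneg)
  ultimately have 1: "ln ((1 + (norm z)\<^sup>2) / (1 + (norm y)\<^sup>2)) = ln (1 + (norm z)\<^sup>2) - (ln (real p) - ln s)"
    using p s by (simp add: ln_div ln_mult)
  have 2: "q \<bullet> \<tau>' = q \<bullet> log_coord z - (entropy (real p) q - real p * ln s)"
    using inner_entropy_grad[OF q(2)] by (simp add: \<tau>'_def inner_diff_right s_def)
  have "decay_fun P p z = - (q \<bullet> \<tau>') + real p * ln ((1 + (norm z)\<^sup>2) / (1 + (norm y)\<^sup>2))"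
    using flow_data_eq[OF assms] by (simp add: decay_fun_def \<tau>'_def y_def)
  then show ?thesis
    unfolding 1 2 by (simp add: algebra_simps)
qed

section \<open>Position of the orbits, and density of the interior of a region\<close>

lemma face_cone_subset_orthogonal_comp:
  assumes "finite S" "F \<in> open_faces (convex hull S)"
  shows "face_cone (convex hull S) F \<subseteq> (face_tangent F)\<^sup>\<bottom>"
proof -
  obtain q where "q \<in> F" using open_face_nonempty[OF assms(2)] by blast
  then show ?thesis
    by (rule_tac open_face_convex_hull_decomposition[OF assms]) blast
qed

text \<open>Imaginary parts of the exponent do not change the logarithmic coordinates, so the whole
  orbit keeps the point \<open>q\<close> of \<open>z0\<close>.\<close>

lemma normal_orbit_subset_region:
  assumes P: "compact P" and F: "F \<in> open_faces P" and p: "0 < p"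
    and z0: "z0 \<in> torus" "real p *\<^sub>R moment_map z0 \<in> F"
  shows "normal_orbit P F z0 \<subseteq> region P p F"
proof
  fix w assume "w \<in> normal_orbit P F z0"
  then obtain \<tau> \<theta> where \<tau>: "\<tau> \<in> face_cone P F"
    and w: "w = exp_act (\<chi> j. Complex (\<tau> $ j) (\<theta> $ j)) z0"
    by (auto simp: normal_orbit_def complexified_cone_def)
  define q where "q = real p *\<^sub>R moment_map z0"
  have "q \<in> P" using open_face_eq[OF F z0(2)] z0(2) by (auto simp: q_def)
  then have "2 *\<^sub>R \<tau> \<in> face_cone P F"
    using normal_cone_scale[OF P] \<tau> face_cone_eq[OF F z0(2)] by (simp add: q_def)
  moreover have "log_coord w - entropy_grad (real p) q = 2 *\<^sub>R \<tau>"
    using z0 p by (simp add: w q_def entropy_grad_moment_map log_coord_exp_act)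
  ultimately show "w \<in> region P p F"
    using z0 p moment_map_in_open_simplex[OF z0(1), of "real p"]
    by (auto simp: region_iff[OF P F p] w q_def intro!: bexI[OF _ z0(2)])
qed

text \<open>Points where the cone inequalities hold strictly are interior, and a small push along
  \<open>u0\<close> makes them strict. This gives the limits in \<open>limit_zero_form\<close> a
  meaning at non-interior points.\<close>

lemma region_subset_closure_interior:
  fixes S :: "(real^'m) set"
  assumes S: "finite S" and P: "P = convex hull S" and F: "F \<in> open_faces P" and p: "0 < p"
  shows "region P p F \<subseteq> closure (interior (region P p F))"
proof
  fix w assume w: "w \<in> region P p F"
  note F' = F[unfolded P]
  have cP: "compact P" using S P by (simp add: finite_imp_compact_convex_hull)
  let ?D = "open_simplex (real p) :: (real^'m) set" and ?g = "entropy_grad (real p) :: real^'m \<Rightarrow> real^'m"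
  obtain A where "A \<subseteq> S" and relopen: "\<And>q. q \<in> F \<Longrightarrow> \<exists>U. open U \<and> F = U \<inter> {x. x - q \<in> face_tangent F}"
    and cone: "\<And>u x. x \<in> F \<Longrightarrow> u \<in> face_cone P F \<longleftrightarrow>
       u \<in> (face_tangent F)\<^sup>\<bottom> \<and> (\<forall>s\<in>S - A. u \<bullet> s \<le> u \<bullet> x)"
    and "\<exists>u0\<in>(face_tangent F)\<^sup>\<bottom>. \<forall>x\<in>F. \<forall>s\<in>S - A. u0 \<bullet> s < u0 \<bullet> x"
    by (rule open_face_convex_hull_decomposition[OF S F', folded P]) blast
  then obtain u0 where u0: "u0 \<in> (face_tangent F)\<^sup>\<bottom>" "\<And>x s. x \<in> F \<Longrightarrow> s \<in> S - A \<Longrightarrow> u0 \<bullet> s < u0 \<bullet> x"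
    by blast
  obtain q where wt: "w \<in> torus" and q: "q \<in> F" "q \<in> ?D" "log_coord w - ?g q \<in> face_cone P F"
    using w region_iff[OF cP F p] by blast
  obtain U where U: "open U" "F = U \<inter> {x. x - q \<in> face_tangent F}"
    using relopen[OF q(1)] by blast
  obtain \<Omega> Q Q' where \<Omega>: "open \<Omega>"
    and Q: "\<And>r. r \<in> \<Omega> \<Longrightarrow> Q r \<in> ?D \<and> Q r - q \<in> face_tangent F \<and> r - ?g (Q r) \<in> (face_tangent F)\<^sup>\<bottom>"
    and QI: "\<And>r x. \<lbrakk>x \<in> ?D; x - q \<in> face_tangent F; r - ?g x \<in> (face_tangent F)\<^sup>\<bottom>\<rbrakk> \<Longrightarrow> r \<in> \<Omega> \<and> Q r = x"
    and dQ: "\<And>r. r \<in> \<Omega> \<Longrightarrow> (Q has_derivative Q' r) (at r)"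
    by (rule constrained_entropy_grad_inverse[of "face_tangent F" "real p" q])
      (simp add: face_tangent_def, blast)
  define X where "X = torus \<inter> log_coord -` \<Omega>"
  have cl: "continuous_on torus log_coord"
    using has_derivative_log_coord has_derivative_continuous by (blast intro: continuous_at_imp_continuous_on)
  have oX: "open X"
    unfolding X_def by (rule continuous_open_preimage[OF cl open_torus \<Omega>])
  have clX: "continuous_on X log_coord"
    by (rule continuous_on_subset[OF cl]) (auto simp: X_def)
  have "continuous_on \<Omega> Q"
    using dQ has_derivative_continuous by (blast intro: continuous_at_imp_continuous_on)
  from continuous_on_compose2[OF this clX] have cQ: "continuous_on X (\<lambda>z. Q (log_coord z))"
    by (auto simp: X_def)
  have "continuous_on ?D ?g"
    using has_derivative_entropy_grad has_derivative_continuous by (blast intro: continuous_at_imp_continuous_on)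
  from continuous_on_compose2[OF this cQ] have cg: "continuous_on X (\<lambda>z. ?g (Q (log_coord z)))"
    using Q by (auto simp: X_def)
  define \<phi> where "\<phi> s z = (log_coord z - ?g (Q (log_coord z))) \<bullet> (s - Q (log_coord z))" for s z
  \<comment> \<open>\<open>U\<close> keeps \<open>q\<close> in the face, and negativity of
    \<open>\<phi> s\<close> is the strict cone inequality at \<open>s\<close>; all these conditions
    are open.\<close>
  define W where "W = (X \<inter> (\<lambda>z. Q (log_coord z)) -` U) \<inter> (\<Inter>s\<in>S - A. X \<inter> \<phi> s -` {..<0})"
  have "open (X \<inter> \<phi> s -` {..<0})" for s
    unfolding \<phi>_def by (intro continuous_open_preimage[OF _ oX] continuous_intros clX cg cQ)
  then have "open W"
    unfolding W_def using S
    by (intro open_Int[OF continuous_open_preimage[OF cQ oX U(1)]] open_INT) auto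
  moreover have "W \<subseteq> region P p F"
  proof
    fix z assume z: "z \<in> W"
    then have z': "z \<in> torus" "log_coord z \<in> \<Omega>" "Q (log_coord z) \<in> U"
      by (auto simp: W_def X_def)
    have QF: "Q (log_coord z) \<in> F"
      using Q[OF z'(2)] z'(3) U(2) by blast
    have "(log_coord z - ?g (Q (log_coord z))) \<bullet> s \<le> (log_coord z - ?g (Q (log_coord z))) \<bullet> Q (log_coord z)"
      if "s \<in> S - A" for s
    proof -
      have "z \<in> X \<inter> \<phi> s -` {..<0}" using z that unfolding W_def by blast
      then have "\<phi> s z < 0" by simp
      then show ?thesis unfolding \<phi>_def by (subst (asm) inner_diff_right) simp
    qed
    then have "log_coord z - ?g (Q (log_coord z)) \<in> face_cone P F"
      using Q[OF z'(2)] cone[OF QF] by blast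
    then show "z \<in> region P p F"
      using QF Q[OF z'(2)] z'(1) region_iff[OF cP F p] by blast
  qed
  ultimately have W: "W \<subseteq> interior (region P p F)"
    by (rule interior_maximal[rotated])
  define c where "c e = exp_act (cvec (e *\<^sub>R u0)) w" for e :: real
  \<comment> \<open>Moving along \<open>u0\<close>, which is normal to the face, leaves
    \<open>Q\<close> equal to \<open>q\<close> and lowers every \<open>\<phi> s\<close>
    strictly.\<close>
  have "c e \<in> W" if "0 < e" for e
  proof -
    have lc: "log_coord (c e) = log_coord w + (2 * e) *\<^sub>R u0"
      using wt by (simp add: c_def log_coord_exp_act_cvec)
    have "log_coord w - ?g q \<in> (face_tangent F)\<^sup>\<bottom>"
      using q(3) cone[OF q(1)] by blast
    then have "(log_coord w - ?g q) + (2 * e) *\<^sub>R u0 \<in> (face_tangent F)\<^sup>\<bottom>"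
      using u0(1) by (intro subspace_add subspace_scale subspace_orthogonal_comp)
    then have "log_coord (c e) - ?g q \<in> (face_tangent F)\<^sup>\<bottom>"
      by (simp add: lc algebra_simps)
    moreover have "q - q \<in> face_tangent F"
      by (simp add: face_tangent_def span_zero)
    ultimately have Qc: "log_coord (c e) \<in> \<Omega>" "Q (log_coord (c e)) = q"
      using QI[OF q(2)] by blast+
    have "\<phi> s (c e) < 0" if "s \<in> S - A" for s
    proof -
      have "(log_coord w - ?g q) \<bullet> (s - q) \<le> 0" "u0 \<bullet> (s - q) < 0"
        using cone[OF q(1)] q(3) u0(2)[OF q(1)] that by (auto simp: inner_diff_right)
      then have "(log_coord w - ?g q) \<bullet> (s - q) + (2 * e) * (u0 \<bullet> (s - q)) < 0"
        using \<open>0 < e\<close> by (intro add_nonpos_neg mult_pos_neg) auto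
      then show ?thesis
        unfolding \<phi>_def Qc(2) unfolding lc by (simp add: inner_diff_left inner_add_left)
    qed
    moreover have "c e \<in> torus" using wt by (simp add: c_def)
    ultimately show ?thesis
      using Qc U(2) q(1) by (auto simp: W_def X_def)
  qed
  then have "eventually (\<lambda>e. c e \<in> interior (region P p F)) (at_right 0)"
    using W by (auto simp: eventually_at_filter intro!: always_eventually)
  moreover have "(c \<longlongrightarrow> c 0) (at_right 0)"
  proof -
    have "isCont c 0"
      unfolding c_def exp_act_def cvec_def isCont_def vec_lambda_beta
      by (intro tendsto_vec_lambda tendsto_intros)
    then show ?thesis
      by (auto simp: isCont_def intro: tendsto_within_subset)
  qed
  ultimately have "c 0 \<in> closure (interior (region P p F))"
    using closure_subset
    by (intro Lim_in_closed_set[of _ c "at_right 0"]) (auto elim!: eventually_mono)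
  then show "w \<in> closure (interior (region P p F))"
    by (simp add: c_def)
qed


section \<open>Tangent vectors of the orbits\<close>

text \<open>The sum is the logarithmic derivative of a character along the curve, which vanishes
  when the character is constant.\<close>

lemma integer_product_constant_derivative:
  fixes \<gamma> :: "real \<Rightarrow> complex^'m"
  assumes nz: "\<And>j. \<gamma> 0 $ j \<noteq> 0"
    and const: "\<And>t. t \<in> {0..1} \<Longrightarrow> (\<Prod>j\<in>UNIV. (\<gamma> t $ j / \<gamma> 0 $ j) powi n j) = 1"
    and der: "(\<gamma> has_vector_derivative v) (at 0 within {0..1})"
  shows "(\<Sum>j\<in>UNIV. of_int (n j) * v $ j / \<gamma> 0 $ j) = 0"
proof -
  have dj: "((\<lambda>t. \<gamma> t $ j) has_derivative (\<lambda>t. t *\<^sub>R v $ j)) (at 0 within {0..1})" for j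
    using bounded_linear.has_derivative[OF bounded_linear_vec_nth der[unfolded has_vector_derivative_def]]
    by simp
  have "((\<lambda>t. \<Prod>j\<in>UNIV. (\<gamma> t $ j / \<gamma> 0 $ j) powi n j) has_derivative
      (\<lambda>t. t *\<^sub>R (\<Sum>j\<in>UNIV. of_int (n j) * v $ j / \<gamma> 0 $ j))) (at 0 within {0..1})"
    by (rule has_derivative_eq_rhs[OF has_derivative_prod[OF has_derivative_power_int[OF _
            bounded_linear.has_derivative[OF bounded_linear_divide dj]]]])
      (auto simp: nz sum_distrib_left scaleR_conv_of_real fun_eq_iff mult_ac)
  then have "((\<lambda>t. 1) has_vector_derivative (\<Sum>j\<in>UNIV. of_int (n j) * v $ j / \<gamma> 0 $ j)) (at 0 within {0..1::real})"
    unfolding has_vector_derivative_def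
    by (rule has_derivative_transform[rotated 2]) (auto simp: const)
  \<comment> \<open>One-sided derivatives at the end of a nondegenerate interval are still
    unique.\<close>
  then show ?thesis
    using vector_derivative_unique_within_closed_interval[of 0 1 0 "\<lambda>t. 1" _ "0 :: complex"]
    by (simp add: has_vector_derivative_const)
qed

text \<open>The torus coordinates along an orbit are only determined modulo \<open>2\<pi>\<i>\<close>, so the argument uses
  the characters \<open>z \<mapsto> \<Prod>\<^sub>j z\<^sub>j\<^sup>n\<^sup>j\<close> with \<open>n\<close> integral and tangent to \<open>F\<close>, which are constant on
  orbits; the tangent space of \<open>F\<close> is spanned by such \<open>n\<close> because \<open>P\<close> is integral.\<close>

lemma tangent_space_normal_orbit:
  fixes S :: "(real^'m) set"
  assumes S: "finite S" "\<And>s j. s \<in> S \<Longrightarrow> s $ j \<in> \<int>" and P: "P = convex hull S"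
    and F: "F \<in> open_faces P" and z0: "z0 \<in> torus"
    and \<xi>: "\<xi> \<in> tangent_space (normal_orbit P F z0) w" and u: "u \<in> face_tangent F"
  shows "(\<Sum>j\<in>UNIV. complex_of_real (u $ j) * \<xi> $ j / w $ j) = 0"
proof -
  note F' = F[unfolded P]
  obtain A where A: "A \<subseteq> S" and T: "face_tangent F = span {s - s' | s s'. s \<in> A \<and> s' \<in> A}"
    by (rule open_face_convex_hull_decomposition[OF S(1) F']) blast
  let ?L = "\<lambda>u \<xi>. \<Sum>j\<in>UNIV. complex_of_real (u $ j) * \<xi> $ j / w $ j"
  have curve: "?L u v = 0"
    if \<gamma>: "\<gamma> 0 = w" "\<forall>t\<in>{0..1}. \<gamma> t \<in> normal_orbit P F z0"
      "(\<gamma> has_vector_derivative v) (at 0 within {0..1})" and u: "u \<in> face_tangent F" for \<gamma> v u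
  proof -
    have int: "?L (s - s') v = 0" if s: "s \<in> A" "s' \<in> A" for s s'
    proof -
      \<comment> \<open>Generators are lattice points, so the floor only changes the type.\<close>
      define n where "n j = \<lfloor>(s - s') $ j\<rfloor>" for j
      have n: "complex_of_real ((s - s') $ j) = of_int (n j)" for j
      proof -
        have "(s - s') $ j \<in> \<int>" using S(2) A s by (auto intro!: Ints_diff)
        then have "real_of_int (n j) = (s - s') $ j" by (simp add: n_def of_int_floor)
        then show ?thesis by (metis of_real_of_int_eq)
      qed
      have nT: "s - s' \<in> face_tangent F"
        unfolding T using s by (intro span_base) blast
      \<comment> \<open>The exponent is chosen for each \<open>t\<close> separately, without
        continuity in \<open>t\<close>; only the character, which ignores this choice, gets
        differentiated.\<close>
      have "\<exists>\<eta>. \<gamma> t = exp_act \<eta> z0 \<and> (\<Sum>j\<in>UNIV. of_int (n j) * \<eta> $ j) = 0" if t: "t \<in> {0..1}" for t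
      proof -
        obtain \<tau> \<theta> where \<tau>: "\<tau> \<in> face_cone P F" "\<theta> \<in> (face_tangent F)\<^sup>\<bottom>"
          and w: "\<gamma> t = exp_act (\<chi> j. Complex (\<tau> $ j) (\<theta> $ j)) z0"
          using \<gamma>(2) t by (force simp: normal_orbit_def complexified_cone_def)
        have "\<tau> \<in> (face_tangent F)\<^sup>\<bottom>"
          using \<tau>(1) face_cone_subset_orthogonal_comp[OF S(1) F'] P by blast
        then have "(\<Sum>j\<in>UNIV. (s - s') $ j * \<tau> $ j) = 0" "(\<Sum>j\<in>UNIV. (s - s') $ j * \<theta> $ j) = 0"
          using \<tau>(2) nT by (auto simp: orthogonal_comp_def orthogonal_def inner_vec_def)
        then have "(\<Sum>j\<in>UNIV. complex_of_real ((s - s') $ j) * Complex (\<tau> $ j) (\<theta> $ j)) = 0"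
          by (simp add: complex_eq_iff)
        then show ?thesis
          using w by (intro exI[of _ "\<chi> j. Complex (\<tau> $ j) (\<theta> $ j)"]) (simp add: n[symmetric])
      qed
      then obtain \<eta> where \<eta>: "\<And>t. t \<in> {0..1} \<Longrightarrow> \<gamma> t = exp_act (\<eta> t) z0"
          "\<And>t. t \<in> {0..1} \<Longrightarrow> (\<Sum>j\<in>UNIV. of_int (n j) * \<eta> t $ j) = 0"
        by metis
      have z0nz: "z0 $ j \<noteq> 0" for j using z0 by (simp add: torus_def)
      have const: "(\<Prod>j\<in>UNIV. (\<gamma> t $ j / \<gamma> 0 $ j) powi n j) = 1" if t: "t \<in> {0..1}" for t
      proof -
        have "\<gamma> t $ j / \<gamma> 0 $ j = exp (\<eta> t $ j - \<eta> 0 $ j)" for j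
          using \<eta>(1)[OF t] \<eta>(1)[of 0] z0nz by (simp add: exp_act_def exp_diff)
        then have "(\<Prod>j\<in>UNIV. (\<gamma> t $ j / \<gamma> 0 $ j) powi n j)
            = exp (\<Sum>j\<in>UNIV. of_int (n j) * (\<eta> t $ j - \<eta> 0 $ j))"
          by (simp add: exp_sum exp_power_int mult.commute)
        also have "(\<Sum>j\<in>UNIV. of_int (n j) * (\<eta> t $ j - \<eta> 0 $ j)) = 0"
          using \<eta>(2)[OF t] \<eta>(2)[of 0] by (simp add: right_diff_distrib sum_subtractf)
        finally show ?thesis by simp
      qed
      have "\<gamma> 0 $ j \<noteq> 0" for j
        using \<eta>(1)[of 0] z0nz by (simp add: exp_act_def)
      from integer_product_constant_derivative[OF this const \<gamma>(3)]
      show ?thesis unfolding n using \<gamma>(1) by simp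
    qed
    \<comment> \<open>Linearity extends the relation from integral differences of generators to
      their real span.\<close>
    have "subspace {u. ?L u v = 0}"
      by (auto simp: subspace_def distrib_right add_divide_distrib sum.distrib mult.assoc
          simp flip: sum_distrib_left times_divide_eq_right)
    then have "face_tangent F \<subseteq> {u. ?L u v = 0}"
      unfolding T by (intro span_minimal) (use int in blast)+
    then show ?thesis using u by blast
  qed
  have "?L u (x + y) = ?L u x + ?L u y" for x y
    by (simp add: distrib_left add_divide_distrib sum.distrib)
  moreover have "?L u (c *\<^sub>R x) = complex_of_real c * ?L u x" for c x
    unfolding sum_distrib_left
    by (rule sum.cong) (simp_all add: scaleR_conv_of_real[where 'a = complex])
  ultimately have "subspace {\<xi>. ?L u \<xi> = 0}"
    by (auto simp: subspace_def)
  then have "tangent_space (normal_orbit P F z0) w \<subseteq> {\<xi>. ?L u \<xi> = 0}"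
    unfolding tangent_space_def by (intro span_minimal) (use curve u in blast)+
  then show ?thesis using \<xi> by blast
qed


section \<open>The limit expected zero current\<close>

text \<open>\<open>R z j\<close> is the derivative of \<open>q\<close> in the j-th logarithmic
  coordinate, tangential because \<open>q\<close> moves inside \<open>F\<close>.\<close>

lemma limit_zero_form_on_region:
  fixes S :: "(real^'m) set"
  assumes S: "finite S" and P: "P = convex hull S" and p: "0 < p"
    and F: "F \<in> open_faces P" "\<not> F \<subseteq> frontier (scaled_simplex p)"
  obtains R where "\<And>z j. z \<in> region P p F \<Longrightarrow> R z j \<in> face_tangent F"
    "\<And>z. z \<in> region P p F \<Longrightarrow> limit_zero_form P p z =
       (\<chi> j k. \<i> / (2 * complex_of_real pi) * (complex_of_real (R z j $ k) / (z $ j * cnj (z $ k))))"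
proof -
  note F' = F(1)[unfolded P]
  have cP: "compact P" using S P by (simp add: finite_imp_compact_convex_hull)
  let ?D = "open_simplex (real p) :: (real^'m) set" and ?g = "entropy_grad (real p) :: real^'m \<Rightarrow> real^'m"
  let ?T = "face_tangent F"
  obtain q where q: "q \<in> F" using open_face_nonempty[OF F(1)] by blast
  obtain \<Omega> Q Q' where \<Omega>: "open \<Omega>"
    and Q: "\<And>r. r \<in> \<Omega> \<Longrightarrow> Q r \<in> ?D \<and> Q r - q \<in> ?T \<and> r - ?g (Q r) \<in> ?T\<^sup>\<bottom>"
    and QI: "\<And>r x. \<lbrakk>x \<in> ?D; x - q \<in> ?T; r - ?g x \<in> ?T\<^sup>\<bottom>\<rbrakk> \<Longrightarrow> r \<in> \<Omega> \<and> Q r = x"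
    and dQ: "\<And>r. r \<in> \<Omega> \<Longrightarrow> (Q has_derivative Q' r) (at r)"
    and Q'T: "\<And>r v. r \<in> \<Omega> \<Longrightarrow> Q' r v \<in> ?T"
    and cQ': "\<And>v. continuous_on \<Omega> (\<lambda>r. Q' r v)"
    by (rule constrained_entropy_grad_inverse[of ?T "real p" q]) (simp add: face_tangent_def, blast)
  have flow: "z \<in> torus" "log_coord z \<in> \<Omega>" "Q (log_coord z) \<in> P" "Q (log_coord z) \<in> ?D"
      "log_coord z - ?g (Q (log_coord z)) \<in> normal_cone P (Q (log_coord z))"
    if z: "z \<in> region P p F" for z
  proof -
    obtain x where x: "z \<in> torus" "x \<in> F" "x \<in> ?D" "log_coord z - ?g x \<in> face_cone P F"
      using z region_iff[OF cP F(1) p] by blast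
    have "x - q \<in> ?T"
      unfolding face_tangent_def using x(2) q by (intro span_base) blast
    moreover have "log_coord z - ?g x \<in> ?T\<^sup>\<bottom>"
      using x(4) face_cone_subset_orthogonal_comp[OF S F'] P by blast
    ultimately have "log_coord z \<in> \<Omega>" "Q (log_coord z) = x"
      using QI[OF x(3)] by blast+
    then show "z \<in> torus" "log_coord z \<in> \<Omega>" "Q (log_coord z) \<in> P" "Q (log_coord z) \<in> ?D"
        "log_coord z - ?g (Q (log_coord z)) \<in> normal_cone P (Q (log_coord z))"
      using x face_cone_eq[OF F(1) x(2)] open_face_eq[OF F(1) x(2)] by auto
  qed
  \<comment> \<open>This extends the potential from the region to all of \<open>\<Omega>\<close>:
    the maximum over \<open>P\<close> is replaced by one over the slice of the open simplex through
    \<open>q\<close> in the directions of \<open>?T\<close>.\<close>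
  define h where "h r = Q r \<bullet> r - entropy (real p) (Q r) + real p * ln (real p)" for r
  have dh: "(h has_derivative (\<lambda>v. Q r \<bullet> v)) (at r)" if r: "r \<in> \<Omega>" for r
  proof -
    have "(h has_derivative (\<lambda>v. Q r \<bullet> v + Q' r v \<bullet> r - ?g (Q r) \<bullet> Q' r v)) (at r)"
      unfolding h_def[abs_def]
      by (rule derivative_eq_intros dQ[OF r] refl
          has_derivative_compose[OF dQ[OF r] has_derivative_entropy] | use Q[OF r] in simp)+
    \<comment> \<open>The envelope argument: \<open>Q' r v\<close> is tangential and
      \<open>r - ?g (Q r)\<close> is normal, so moving the maximizer does not contribute to first
      order.\<close>
    moreover have "Q' r v \<bullet> r - ?g (Q r) \<bullet> Q' r v = 0" for v
    proof -
      have "Q' r v \<bullet> (r - ?g (Q r)) = 0"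
        using Q[OF r] Q'T[OF r, of v] by (auto simp: orthogonal_comp_def orthogonal_def)
      then show ?thesis by (simp add: inner_diff_right inner_commute)
    qed
    ultimately show ?thesis
      by (simp add: add_diff_eq[symmetric])
  qed
  \<comment> \<open>This expression is also defined and continuous at non-interior points of the
    region, since \<open>\<Omega>\<close> is a neighbourhood of their logarithmic
    coordinates.\<close>
  define \<Xi> where "\<Xi> z = (\<chi> j k. \<i> / (2 * complex_of_real pi) *
      (complex_of_real (Q' (log_coord z) (axis j 1) $ k) / (z $ j * cnj (z $ k))))" for z
  define \<psi> where "\<psi> = (\<lambda>w. real p *\<^sub>R omega_FS w - ddbar (decay_fun P p) w)"
  let ?U = "interior (region P p F)"
  have Ut: "?U \<subseteq> torus" using flow(1) interior_subset by blast
  have inner: "\<psi> w = \<Xi> w" if w: "w \<in> ?U" for w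
  proof -
    have reg: "z \<in> region P p F" if "z \<in> ?U" for z using that interior_subset by blast
    obtain L' where L': "(log_partition_grad has_derivative L') (at (log_coord w))"
      using log_partition_grad_differentiable by (auto simp: differentiable_def)
    have 1: "omega_FS w = (\<chi> j k. \<i> / (2 * complex_of_real pi) *
        (complex_of_real (L' (axis j 1) $ k) / (w $ j * cnj (w $ k))))"
      unfolding omega_FS_def
      by (rule ddbar_of_log_coord[OF open_torus order_refl _ _ has_derivative_log_partition L'])
        (use w Ut in \<open>auto simp: log_partition_log_coord\<close>)
    have 2: "ddbar (decay_fun P p) w = (\<chi> j k. \<i> / (2 * complex_of_real pi) *
        (complex_of_real ((real p *\<^sub>R L' (axis j 1) - Q' (log_coord w) (axis j 1)) $ k) / (w $ j * cnj (w $ k))))"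
    proof (rule ddbar_of_log_coord[OF open_interior Ut w])
      show "decay_fun P p z = real p * log_partition (log_coord z) - h (log_coord z)" if "z \<in> ?U" for z
        using decay_fun_eq[OF cP p flow(1,3,4,5)[OF reg[OF that]]] flow(1)[OF reg[OF that]]
        by (simp add: log_partition_log_coord h_def)
      show "((\<lambda>r. real p * log_partition r - h r) has_derivative
          (\<lambda>v. (real p *\<^sub>R log_partition_grad (log_coord z) - Q (log_coord z)) \<bullet> v)) (at (log_coord z))"
        if "z \<in> ?U" for z
        by (rule derivative_eq_intros has_derivative_log_partition dh flow(2) reg that refl)+
          (simp add: inner_diff_left)
      show "((\<lambda>r. real p *\<^sub>R log_partition_grad r - Q r) has_derivative
          (\<lambda>v. real p *\<^sub>R L' v - Q' (log_coord w) v)) (at (log_coord w))"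
        by (intro derivative_intros L' dQ flow(2) reg w)
    qed
    show ?thesis
      unfolding \<psi>_def 1 2 \<Xi>_def vec_eq_iff
        vector_minus_component vector_scaleR_component vec_lambda_beta
      by (simp add: scaleR_conv_of_real diff_divide_distrib algebra_simps)
  qed
  have cont: "isCont \<Xi> z" if z: "z \<in> region P p F" for z
  proof -
    have nz: "z $ j \<noteq> 0" for j using flow(1)[OF z] by (simp add: torus_def)
    have "isCont log_coord z"
      using has_derivative_log_coord[OF flow(1)[OF z]] has_derivative_continuous by blast
    moreover have "isCont (\<lambda>r. Q' r v) (log_coord z)" for v
      using cQ' \<Omega> flow(2)[OF z] by (simp add: continuous_on_eq_continuous_at)
    ultimately have "isCont (\<lambda>z. Q' (log_coord z) v) z" for v
      by (rule isCont_o2)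
    then have "(\<lambda>z. Q' (log_coord z) v) \<midarrow>z\<rightarrow> Q' (log_coord z) v" for v
      by (simp add: isCont_def)
    then show ?thesis
      unfolding \<Xi>_def isCont_def using nz
      by (intro tendsto_vec_lambda tendsto_intros) auto
  qed
  show thesis
  proof (rule that[of "\<lambda>z j. Q' (log_coord z) (axis j 1)"])
    show "Q' (log_coord z) (axis j 1) \<in> ?T" if "z \<in> region P p F" for z j
      using Q'T flow(2)[OF that] by blast
    fix z assume z: "z \<in> region P p F"
    have "limit_zero_form P p z = \<Xi> z"
    proof (cases "z \<in> ?U")
      case True
      then show ?thesis
        by (simp add: limit_zero_form_def region_of_eq[OF cP p F z] inner flip: \<psi>_def)
    next
      case False
      \<comment> \<open>Without this the filter would be trivial and \<open>Lim\<close> would not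
        determine a value.\<close>
      then have "z islimpt ?U"
        using region_subset_closure_interior[OF S P F(1) p] z by (auto simp: closure_def)
      moreover have "(\<Xi> \<longlongrightarrow> \<Xi> z) (at z within ?U)"
        using cont[OF z] unfolding isCont_def by (rule tendsto_within_subset) simp
      then have "(\<psi> \<longlongrightarrow> \<Xi> z) (at z within ?U)"
        by (rule tendsto_cong[THEN iffD1, rotated]) (auto simp: eventually_at_filter inner)
      ultimately have "Lim (at z within ?U) \<psi> = \<Xi> z"
        by (intro tendsto_Lim) (simp_all add: trivial_limit_within)
      then show ?thesis
        using False by (simp add: limit_zero_form_def region_of_eq[OF cP p F z] flip: \<psi>_def)
    qed
    then show "limit_zero_form P p z = (\<chi> j k. \<i> / (2 * complex_of_real pi) *
        (complex_of_real (Q' (log_coord z) (axis j 1) $ k) / (z $ j * cnj (z $ k))))"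
      by (simp add: \<Xi>_def)
  qed
qed

theorem theorem5p5:
  fixes P F :: "(real^'m) set" and p :: nat and z0 :: "complex^'m"
  assumes "p > 0"
    and "integral_polytope P"
    and "P \<subseteq> scaled_simplex p"
    and "\<not> P \<subseteq> frontier (scaled_simplex p)"
    and "F \<in> open_faces P"
    and "\<not> F \<subseteq> frontier (scaled_simplex p)"
    and "z0 \<in> torus"
    and "moment_map z0 \<in> (\<lambda>x. (1 / real p) *\<^sub>R x) ` F"
  shows "restricts_to_zero (limit_zero_form P p) (normal_orbit P F z0)"
  unfolding restricts_to_zero_def
proof (intro ballI)
  fix w \<xi> \<zeta>
  let ?O = "normal_orbit P F z0"
  assume w: "w \<in> ?O" and \<xi>: "\<xi> \<in> tangent_space ?O w" and \<zeta>: "\<zeta> \<in> tangent_space ?O w"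
  obtain S where S: "finite S" "\<And>s j. s \<in> S \<Longrightarrow> s $ j \<in> \<int>" "P = convex hull S"
    using assms(2) unfolding integral_polytope_def by blast
  have P: "compact P" using S by (simp add: finite_imp_compact_convex_hull)
  have "real p *\<^sub>R moment_map z0 \<in> F"
    using assms(1,8) by auto
  then have wR: "w \<in> region P p F"
    using w normal_orbit_subset_region[OF P assms(5,1,7)] by blast
  obtain R where R: "\<And>j. R j \<in> face_tangent F"
    and form: "limit_zero_form P p w = (\<chi> j k. \<i> / (2 * complex_of_real pi) *
        (complex_of_real (R j $ k) / (w $ j * cnj (w $ k))))"
    by (rule limit_zero_form_on_region[OF S(1,3) assms(1,5,6)]) (use wR in blast)
  \<comment> \<open>Since \<open>R j\<close> is real, the sum is, up to the factor
    \<open>1 / w $ j\<close>, the conjugate of the pairing of \<open>R j\<close> with the orbit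
    vector \<open>v\<close>.\<close>
  have contract: "(\<Sum>k\<in>UNIV. complex_of_real (R j $ k) / (w $ j * cnj (w $ k)) * cnj (v $ k)) = 0"
    if v: "v \<in> tangent_space ?O w" for j v
  proof -
    have "(\<Sum>k\<in>UNIV. complex_of_real (R j $ k) / (w $ j * cnj (w $ k)) * cnj (v $ k))
        = cnj (\<Sum>k\<in>UNIV. complex_of_real (R j $ k) * v $ k / w $ k) / w $ j"
      by (simp add: sum_divide_distrib mult_ac)
    then show ?thesis
      using tangent_space_normal_orbit[OF S(1,2,3) assms(5,7) v R] by simp
  qed
  \<comment> \<open>In both terms of the alternating form the second index is contracted with an
    orbit vector.\<close>
  have "form_eval (limit_zero_form P p w) \<xi> \<zeta> = (\<Sum>j\<in>UNIV. \<i> / (2 * complex_of_real pi) *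
      (\<xi> $ j * (\<Sum>k\<in>UNIV. complex_of_real (R j $ k) / (w $ j * cnj (w $ k)) * cnj (\<zeta> $ k))
     - \<zeta> $ j * (\<Sum>k\<in>UNIV. complex_of_real (R j $ k) / (w $ j * cnj (w $ k)) * cnj (\<xi> $ k))))"
    unfolding form_eval_def form
    by (simp add: sum_distrib_left right_diff_distrib diff_divide_distrib sum_subtractf mult_ac)
  then show "form_eval (limit_zero_form P p w) \<xi> \<zeta> = 0"
    using contract[OF \<xi>] contract[OF \<zeta>] by simp
qed

end
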